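(* Let $z_0\in\mathbb{R}^{N+1}$ and $r>0$ be arbitrary, and let $B=B(z_0,r)$ be the caloric bowl of bottom $z_0$ and opening $r$, with normal boundary $\partial_n B=\partial_n B(z_0,r)$. Then for every continuous function $\varphi:\partial_n B\to\mathbb{R}$ there exists a unique function $u_\varphi^B: B\cup\partial_n B\to\mathbb{R}$ which is caloric in $B$, continuous on $B\cup\partial_n B$, and satisfies $$u_\varphi^B(z)=\varphi(z)\quad\text{for every } z\in\partial_n B .$$ Moreover, $u_\varphi^B\ge 0$ if $\varphi\ge 0$.
   Context: $N\ge 1$ is an integer; points of $\mathbb{R}^{N+1}$ are written $z=(x,t)$ with $x\in\mathbb{R}^N$, $t\in\mathbb{R}$, and $|x|$ is the Euclidean norm of $x$. The heat operator is $H=\Delta-\partial_t$, with $\Delta=\sum_{j=1}^N\partial_{x_j}^2$. A function is caloric in an open set if it is real-valued, $C^\infty$ there, and satisfies $Hu=0$ there. For $z_0=(x_0,t_0)\in\mathbb{R}^{N+1}$ and $r>0$, the caloric bowl of bottom $z_0$ and opening $r$ is the open set $$B(z_0,r)=\{(x,t)\in\mathbb{R}^{N+1} : |x-x_0|^2<t-t_0<r^2\},$$ and its normal (or caloric) boundary is $$\partial_n B(z_0,r)=\{(x,t)\in\mathbb{R}^{N+1} : |x-x_0|^2=t-t_0,\ 0\le t-t_0\le r^2\}.$$ *)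

theory Defs
  imports "HOL-Analysis.Analysis"
begin

definition partial_deriv ::
    "'a::real_normed_vector \<Rightarrow> ('a \<Rightarrow> real) \<Rightarrow> 'a \<Rightarrow> real" where
  "partial_deriv b f z = deriv (\<lambda>h. f (z + h *\<^sub>R b)) 0"

(* Meant for open S: the partial derivatives of order up to k exist and are continuous on S. *)
fun Ck_on :: "nat \<Rightarrow> ('a::euclidean_space \<Rightarrow> real) \<Rightarrow> 'a set \<Rightarrow> bool" where
  "Ck_on 0 f S \<longleftrightarrow> continuous_on S f"
| "Ck_on (Suc k) f S \<longleftrightarrow>
     continuous_on S f \<and>
     (\<forall>b\<in>Basis. (\<forall>z\<in>S. (\<lambda>h. f (z + h *\<^sub>R b)) field_differentiable (at 0)) \<and>
                Ck_on k (partial_deriv b f) S)"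

definition Cinf_on :: "('a::euclidean_space \<Rightarrow> real) \<Rightarrow> 'a set \<Rightarrow> bool" where
  "Cinf_on f S \<longleftrightarrow> (\<forall>k. Ck_on k f S)"

definition d_x :: "'n::finite \<Rightarrow> ((real^'n) \<times> real \<Rightarrow> real) \<Rightarrow> (real^'n) \<times> real \<Rightarrow> real" where
  "d_x j = partial_deriv (axis j 1, 0)"

definition d_t :: "((real^'n::finite) \<times> real \<Rightarrow> real) \<Rightarrow> (real^'n) \<times> real \<Rightarrow> real" where
  "d_t = partial_deriv (0, 1)"

definition heat_op :: "((real^'n::finite) \<times> real \<Rightarrow> real) \<Rightarrow> (real^'n) \<times> real \<Rightarrow> real" where
  "heat_op u z = (\<Sum>j\<in>UNIV. d_x j (d_x j u) z) - d_t u z"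

definition caloric_on :: "((real^'n::finite) \<times> real \<Rightarrow> real) \<Rightarrow> ((real^'n) \<times> real) set \<Rightarrow> bool" where
  "caloric_on u S \<longleftrightarrow> Cinf_on u S \<and> (\<forall>z\<in>S. heat_op u z = 0)"

definition bowl :: "(real^'n::finite) \<times> real \<Rightarrow> real \<Rightarrow> ((real^'n) \<times> real) set" where
  "bowl z0 r = {(x, t). (norm (x - fst z0))\<^sup>2 < t - snd z0 \<and> t - snd z0 < r\<^sup>2}"

definition normal_boundary :: "(real^'n::finite) \<times> real \<Rightarrow> real \<Rightarrow> ((real^'n) \<times> real) set" where
  "normal_boundary z0 r =
     {(x, t). (norm (x - fst z0))\<^sup>2 = t - snd z0 \<and> 0 \<le> t - snd z0 \<and> t - snd z0 \<le> r\<^sup>2}"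

(* Membership in extensional encodes that the domain of u is exactly the bowl together with
   its normal boundary; uniqueness of u is then uniqueness on that set. *)
definition bowl_solution ::
    "(real^'n::finite) \<times> real \<Rightarrow> real \<Rightarrow> ((real^'n) \<times> real \<Rightarrow> real) \<Rightarrow>
     ((real^'n) \<times> real \<Rightarrow> real) \<Rightarrow> bool" where
  "bowl_solution z0 r \<phi> u \<longleftrightarrow>
     u \<in> extensional (bowl z0 r \<union> normal_boundary z0 r) \<and>
     caloric_on u (bowl z0 r) \<and>
     continuous_on (bowl z0 r \<union> normal_boundary z0 r) u \<and>
     (\<forall>z\<in>normal_boundary z0 r. u z = \<phi> z)"

end

theory Submission
  imports Defs "HOL-Library.Function_Algebras"
begin

text \<open>Write \<open>d(x,t) = t - t\<^sub>0 - |x - x\<^sub>0|\<^sup>2\<close>, so that the normal boundary lies in \<open>d = 0\<close>. For each \<open>m\<close>, the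
  linear map \<open>q \<mapsto> H(d q)\<close> sends the finite-dimensional space of polynomials of parabolic degree at most
  \<open>m\<close> into itself, and it is injective by the maximum principle, hence surjective. Solving
  \<open>H(d q) = H p\<close> shows that every polynomial \<open>p\<close> agrees on \<open>d = 0\<close> with the caloric polynomial
  \<open>p - d q\<close>. By Stone--Weierstrass the boundary function is a uniform limit of polynomials, and by
  the maximum principle their caloric extensions converge uniformly on the bowl. Bernstein's
  gradient estimate bounds \<open>d |\<nabla>P|\<close> by the supremum of \<open>|P|\<close> for caloric polynomials \<open>P\<close>; applied on
  bowls with slightly raised bottom it makes all derivatives converge locally uniformly, so the
  limit is smooth and caloric. Uniqueness and positivity are the maximum principle.\<close>

section \<open>The weak maximum principle\<close>

text \<open>\<open>heat_jet u z (H u z)\<close> holds for twice differentiable \<open>u\<close>. Unlike \<^const>\<open>heat_op\<close>, which takes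
  arbitrary values without differentiability, this relation is closed under differences.\<close>

definition heat_jet :: "((real^'n::finite) \<times> real \<Rightarrow> real) \<Rightarrow> (real^'n) \<times> real \<Rightarrow> real \<Rightarrow> bool" where
  "heat_jet u z L \<longleftrightarrow> (\<exists>g c \<tau>.
     (\<forall>j. (\<forall>\<^sub>F h in nhds 0. ((\<lambda>h. u (z + h *\<^sub>R (axis j 1, 0))) has_field_derivative g j h) (at h)) \<and>
          (g j has_field_derivative c j) (at 0)) \<and>
     ((\<lambda>h. u (z + h *\<^sub>R (0, 1))) has_field_derivative \<tau>) (at 0) \<and>
     L = (\<Sum>j\<in>UNIV. c j) - \<tau>)"

text \<open>Defining function of the paraboloid. Being a polynomial that vanishes on the normal
  boundary, it also serves as the factor \<open>d\<close> in \<open>p - d q\<close> and as the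
  cut-off in the gradient estimate.\<close>

definition bowl_dist :: "(real^'n::finite) \<times> real \<Rightarrow> (real^'n) \<times> real \<Rightarrow> real" where
  "bowl_dist z0 z = snd z - snd z0 - (norm (fst z - fst z0))\<^sup>2"

lemma bowl_eq: "bowl z0 r = {z. 0 < bowl_dist z0 z \<and> snd z < snd z0 + r\<^sup>2}"
  by (auto simp: bowl_def bowl_dist_def)

lemma normal_boundary_eq:
  "normal_boundary z0 r = {z. bowl_dist z0 z = 0 \<and> snd z \<le> snd z0 + r\<^sup>2}"
proof -
  have "snd z0 \<le> t" if "t - snd z0 = (norm (x - fst z0))\<^sup>2" for x :: "real^'a" and t
    using that zero_le_power2[of "norm (x - fst z0)"] by linarith
  then show ?thesis
    by (auto simp: normal_boundary_def bowl_dist_def)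
qed

lemma continuous_bowl_dist [continuous_intros]: "continuous_on S (bowl_dist z0)"
  unfolding bowl_dist_def by (intro continuous_intros)

lemma heat_jet_diff:
  assumes "heat_jet u z a" and "heat_jet v z b"
  shows "heat_jet (\<lambda>z. u z - v z) z (a - b)"
proof -
  obtain g c \<tau> where u:
      "\<And>j. \<forall>\<^sub>F h in nhds 0. ((\<lambda>h. u (z + h *\<^sub>R (axis j 1, 0))) has_field_derivative g j h) (at h)"
      "\<And>j. (g j has_field_derivative c j) (at 0)"
      "((\<lambda>h. u (z + h *\<^sub>R (0, 1))) has_field_derivative \<tau>) (at 0)" "a = (\<Sum>j\<in>UNIV. c j) - \<tau>"
    using assms(1) unfolding heat_jet_def by blast
  obtain g' c' \<tau>' where v:
      "\<And>j. \<forall>\<^sub>F h in nhds 0. ((\<lambda>h. v (z + h *\<^sub>R (axis j 1, 0))) has_field_derivative g' j h) (at h)"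
      "\<And>j. (g' j has_field_derivative c' j) (at 0)"
      "((\<lambda>h. v (z + h *\<^sub>R (0, 1))) has_field_derivative \<tau>') (at 0)" "b = (\<Sum>j\<in>UNIV. c' j) - \<tau>'"
    using assms(2) unfolding heat_jet_def by blast
  have "\<forall>\<^sub>F h in nhds 0. ((\<lambda>h. u (z + h *\<^sub>R (axis j 1, 0)) - v (z + h *\<^sub>R (axis j 1, 0)))
           has_field_derivative g j h - g' j h) (at h)" for j
    using u(1)[of j] v(1)[of j] by eventually_elim (rule DERIV_diff)
  moreover have "((\<lambda>h. g j h - g' j h) has_field_derivative c j - c' j) (at 0)" for j
    using u(2) v(2) by (rule DERIV_diff)
  moreover have "((\<lambda>h. u (z + h *\<^sub>R (0, 1)) - v (z + h *\<^sub>R (0, 1)))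
      has_field_derivative \<tau> - \<tau>') (at 0)"
    using u(3) v(3) by (rule DERIV_diff)
  ultimately show ?thesis
    unfolding heat_jet_def u(4) v(4)
    by (intro exI[of _ "\<lambda>j h. g j h - g' j h"] exI[of _ "\<lambda>j. c j - c' j"] exI[of _ "\<tau> - \<tau>'"])
      (simp add: sum_subtractf)
qed

text \<open>Supplies the strict perturbation in the maximum principle; with \<open>e = 0\<close> it
  is the jet of the zero function, used for positivity.\<close>

lemma heat_jet_time: "heat_jet (\<lambda>z. e * snd z) z (- e)"
proof -
  have "((\<lambda>h. e * (snd z + h)) has_field_derivative e) (at 0)"
    by (auto intro!: derivative_eq_intros)
  then show ?thesis
    unfolding heat_jet_def
    by (intro exI[of _ "\<lambda>_ _. 0"] exI[of _ "\<lambda>_. 0"] exI[of _ e]) auto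
qed

text \<open>Fermat gives \<open>g 0 = 0\<close>. If \<open>c\<close> were positive, \<open>g\<close>
  would be positive just to the right of 0 and \<open>f\<close> would strictly increase there,
  against the maximum.\<close>

lemma second_derivative_nonpos_at_max:
  fixes f :: "real \<Rightarrow> real"
  assumes d: "\<forall>\<^sub>F h in nhds 0. (f has_field_derivative g h) (at h)"
    and c: "(g has_field_derivative c) (at 0)"
    and m: "\<forall>\<^sub>F h in nhds 0. f h \<le> f 0"
  shows "c \<le> 0"
proof (rule ccontr)
  assume "\<not> c \<le> 0"
  obtain e where e: "e > 0" "\<And>h. \<bar>h\<bar> < e \<Longrightarrow> (f has_field_derivative g h) (at h) \<and> f h \<le> f 0"
    using eventually_conj[OF d m] unfolding eventually_nhds_metric dist_real_def by auto
  have "g 0 = 0"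
    using e by (intro DERIV_local_max[of f _ 0 e]) auto
  with DERIV_pos_inc_right[OF c] \<open>\<not> c \<le> 0\<close>
  obtain e' where e': "e' > 0" "\<And>h. 0 < h \<Longrightarrow> h < e' \<Longrightarrow> 0 < g h"
    by auto
  define b where "b = min e e' / 2"
  have b: "0 < b" "b < e" "b < e'" using e e' by (auto simp: b_def)
  have "f 0 < f b"
  proof (rule DERIV_pos_imp_increasing_open[OF b(1)])
    show "\<exists>y. (f has_field_derivative y) (at x) \<and> y > 0" if "0 < x" "x < b" for x
      using e(2)[of x] e'(2)[of x] that b by auto
    show "continuous_on {0..b} f"
      using e(2) b
      by (intro continuous_at_imp_continuous_on ballI) (metis DERIV_isCont abs_of_nonneg
          atLeastAtMost_iff dual_order.strict_trans2)
  qed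
  with e(2)[of b] b show False by auto
qed

section \<open>Topology of the paraboloid\<close>

lemma bowl_dist_bounded:
  assumes "0 \<le> bowl_dist z0 z" "snd z \<le> s"
  shows "snd z0 \<le> snd z" "dist (fst z0) (fst z) \<le> 1 + s - snd z0"
proof -
  let ?n = "norm (fst z - fst z0)"
  have *: "?n\<^sup>2 \<le> snd z - snd z0" using assms by (simp add: bowl_dist_def)
  moreover have "0 \<le> ?n\<^sup>2" by simp
  ultimately show "snd z0 \<le> snd z" by linarith
  \<comment> \<open>Turns a bound on the square into a bound on the norm without a square root; the
    size of the bound is immaterial.\<close>
  have "?n \<le> 1 + ?n\<^sup>2" 
    using zero_le_power2[of "?n - 1/2"] by (simp add: power2_eq_square algebra_simps)
  with * assms show "dist (fst z0) (fst z) \<le> 1 + s - snd z0"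
    by (simp add: dist_norm norm_minus_commute)
qed

lemma compact_bowl_dist: "compact {z. 0 \<le> bowl_dist z0 z \<and> snd z \<le> s}"
proof -
  have "closed {z. 0 \<le> bowl_dist z0 z \<and> snd z \<le> s}"
    by (intro closed_Collect_conj closed_Collect_le continuous_intros)
  moreover have "bounded {z. 0 \<le> bowl_dist z0 z \<and> snd z \<le> s}"
  proof (rule bounded_subset)
    show "bounded (cball (fst z0) (1 + s - snd z0) \<times> {snd z0..s})"
      by (intro bounded_Times) auto
    show "{z. 0 \<le> bowl_dist z0 z \<and> snd z \<le> s} \<subseteq> cball (fst z0) (1 + s - snd z0) \<times> {snd z0..s}"
      using bowl_dist_bounded[of z0 _ s] by (auto simp: mem_Times_iff)
  qed
  ultimately show ?thesis by (simp add: compact_eq_bounded_closed)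
qed

lemma eventually_bowl_dist_pos:
  assumes "0 < bowl_dist z0 z"
  shows "\<forall>\<^sub>F h in nhds 0. 0 < bowl_dist z0 (z + h *\<^sub>R b)"
proof -
  have "isCont (\<lambda>h. bowl_dist z0 (z + h *\<^sub>R b)) 0"
    unfolding bowl_dist_def by (intro continuous_intros)
  then have "filterlim (\<lambda>h. bowl_dist z0 (z + h *\<^sub>R b)) (nhds (bowl_dist z0 z)) (nhds 0)"
    using tendsto_at_iff_tendsto_nhds[of "\<lambda>h. bowl_dist z0 (z + h *\<^sub>R b)" 0] by (simp add: isCont_def)
  then show ?thesis using assms by (rule order_tendstoD(1))
qed

text \<open>Competitors are only points at times up to that of \<open>z\<close>. Space variations
  keep the time and give \<open>c j \<le> 0\<close>; in time only backward variations are available,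
  and they give \<open>\<tau> \<ge> 0\<close>.\<close>

lemma heat_jet_nonpos_at_max:
  assumes jet: "heat_jet u z L" and pos: "0 < bowl_dist z0 z"
    and max: "\<And>y. 0 \<le> bowl_dist z0 y \<Longrightarrow> snd y \<le> snd z \<Longrightarrow> u y \<le> u z"
  shows "L \<le> 0"
proof -
  obtain g c \<tau> where u:
      "\<And>j. \<forall>\<^sub>F h in nhds 0. ((\<lambda>h. u (z + h *\<^sub>R (axis j 1, 0))) has_field_derivative g j h) (at h)"
      "\<And>j. (g j has_field_derivative c j) (at 0)"
      "((\<lambda>h. u (z + h *\<^sub>R (0, 1))) has_field_derivative \<tau>) (at 0)" "L = (\<Sum>j\<in>UNIV. c j) - \<tau>"
    using jet unfolding heat_jet_def by blast
  have "c j \<le> 0" for j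
  proof (rule second_derivative_nonpos_at_max[OF u(1) u(2)])
    show "\<forall>\<^sub>F h in nhds 0. u (z + h *\<^sub>R (axis j 1, 0)) \<le> u (z + 0 *\<^sub>R (axis j 1, 0))"
      using eventually_bowl_dist_pos[OF pos, of "(axis j 1, 0)"]
    proof eventually_elim
      case (elim h)
      then have "u (z + h *\<^sub>R (axis j 1, 0)) \<le> u z"
        by (intro max) auto
      then show ?case by (simp add: zero_prod_def[symmetric])
    qed
  qed
  then have "(\<Sum>j\<in>UNIV. c j) \<le> 0" by (intro sum_nonpos) auto
  moreover have "\<tau> \<ge> 0"
  proof (rule ccontr)
    assume "\<not> \<tau> \<ge> 0"
    then obtain e where e: "e > 0" "\<And>h. 0 < h \<Longrightarrow> h < e \<Longrightarrow> u z < u (z + (- h) *\<^sub>R (0, 1))"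
      using DERIV_neg_dec_left[OF u(3)] by (auto simp: zero_prod_def[symmetric])
    obtain e' where e': "e' > 0" "\<And>h. \<bar>h\<bar> < e' \<Longrightarrow> 0 < bowl_dist z0 (z + h *\<^sub>R (0, 1))"
      using eventually_bowl_dist_pos[OF pos, of "(0,1)"]
      unfolding eventually_nhds_metric dist_real_def by auto
    define h where "h = min e e' / 2"
    have h: "0 < h" "h < e" "h < e'" using e e' by (auto simp: h_def)
    have "u (z + (- h) *\<^sub>R (0, 1)) \<le> u z"
      using h e'(2)[of "-h"] by (intro max) auto
    with e(2)[of h] h show False by auto
  qed
  ultimately show ?thesis using u(4) by simp
qed

text \<open>Subtracting \<open>a * t\<close> with small \<open>a > 0\<close> makes \<open>u\<close>
  strictly subcaloric, which excludes a maximum at a point with \<open>d > 0\<close>, even on the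
  top lid. Hence no bound on \<open>u\<close> at the top is required.\<close>

lemma weak_max_principle:
  assumes cont: "continuous_on {z. 0 \<le> bowl_dist z0 z \<and> snd z < T} u"
    and jet: "\<And>z. 0 < bowl_dist z0 z \<Longrightarrow> snd z < T \<Longrightarrow> \<exists>L\<ge>0. heat_jet u z L"
    and bd: "\<And>z. bowl_dist z0 z = 0 \<Longrightarrow> snd z < T \<Longrightarrow> u z \<le> M"
    and z: "0 \<le> bowl_dist z0 z" "snd z < T"
  shows "u z \<le> M"
proof (rule field_le_epsilon)
  fix e :: real assume "e > 0"
  \<comment> \<open>With this slope the perturbation changes by at most \<open>e\<close> between the
    bottom and time \<open>T\<close>.\<close>
  define a where "a = e / (1 + (T - snd z0))"
  have sT: "snd z0 < T" using bowl_dist_bounded(1)[OF z(1), of "snd z"] z(2) by simp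
  then have a: "a > 0" "a * (T - snd z0) \<le> e"
    using \<open>e > 0\<close> by (auto simp: a_def field_simps)
  define v where "v = (\<lambda>z. u z - a * snd z)"
  \<comment> \<open>The cut is at the time of \<open>z\<close>, not at \<open>T\<close>: this set is
    compact, and on its lid \<open>u\<close> is still continuous and has a jet.\<close>
  let ?K = "{y. 0 \<le> bowl_dist z0 y \<and> snd y \<le> snd z}"
  have "continuous_on ?K v"
    unfolding v_def using z by (intro continuous_intros continuous_on_subset[OF cont]) auto
  then obtain y where y: "y \<in> ?K" "\<And>x. x \<in> ?K \<Longrightarrow> v x \<le> v y"
    using continuous_attains_sup[OF compact_bowl_dist[of z0 "snd z"], of v] z by blast
  have "\<not> 0 < bowl_dist z0 y"
  proof
    assume pos: "0 < bowl_dist z0 y"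
    with jet[of y] y z obtain L where L: "L \<ge> 0" "heat_jet u y L" by auto
    have "heat_jet v y (L - - a)"
      unfolding v_def by (intro heat_jet_diff L heat_jet_time)
    then have "L - - a \<le> 0"
      by (rule heat_jet_nonpos_at_max[OF _ pos]) (use y in auto)
    then show False using L a by simp
  qed
  then have "bowl_dist z0 y = 0" using y by auto
  then have "u y \<le> M" using y z by (intro bd) auto
  moreover have "v z \<le> v y" using z by (intro y) auto
  moreover have "a * snd z0 \<le> a * snd y"
    using bowl_dist_bounded(1)[of z0 y "snd y"] y(1) a by (intro mult_left_mono) auto
  ultimately have "u z \<le> M + a * (snd z - snd z0)"
    by (simp add: v_def algebra_simps)
  also have "\<dots> \<le> M + a * (T - snd z0)" using a z by simp
  also have "\<dots> \<le> M + e" using a by simp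
  finally show "u z \<le> M + e" .
qed

section \<open>Partial derivatives and heat operator of polynomials\<close>

text \<open>The library hides these introduction rules under their own names.\<close>

lemmas real_polynomial_function_linear = real_polynomial_function.intros(1)
lemmas real_polynomial_function_const = real_polynomial_function.intros(2)
lemmas real_polynomial_function_mult = real_polynomial_function.intros(4)

lemma polynomial_has_partial_deriv_at_0:
  assumes "real_polynomial_function p"
  shows "\<exists>p'. real_polynomial_function p' \<and>
           (\<forall>z. ((\<lambda>h. p (z + h *\<^sub>R b)) has_field_derivative p' z) (at 0))"
  using assms
proof (induction p)
  case (linear f)
  interpret bounded_linear f by fact
  show ?case
    by (intro exI[of _ "\<lambda>_. f b"] conjI allI real_polynomial_function_const)
      (auto simp: add scaleR intro!: derivative_eq_intros)
next
  case (const c)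
  show ?case by (intro exI[of _ "\<lambda>_. 0"]) auto
next
  case (add f g)
  then obtain f' g' where
    "real_polynomial_function f'" "\<And>z. ((\<lambda>h. f (z + h *\<^sub>R b)) has_field_derivative f' z) (at 0)"
    "real_polynomial_function g'" "\<And>z. ((\<lambda>h. g (z + h *\<^sub>R b)) has_field_derivative g' z) (at 0)"
    by blast
  then show ?case
    by (intro exI[of _ "\<lambda>z. f' z + g' z"]) (auto intro: DERIV_add)
next
  case (mult f g)
  then obtain f' g' where *:
    "real_polynomial_function f'" "\<And>z. ((\<lambda>h. f (z + h *\<^sub>R b)) has_field_derivative f' z) (at 0)"
    "real_polynomial_function g'" "\<And>z. ((\<lambda>h. g (z + h *\<^sub>R b)) has_field_derivative g' z) (at 0)"
    by blast
  have "((\<lambda>h. f (z + h *\<^sub>R b) * g (z + h *\<^sub>R b)) has_field_derivative f' z * g z + g' z * f z) (at 0)"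
    for z using DERIV_mult[OF *(2)[of z] *(4)[of z]] by simp
  then show ?case using mult.hyps *
    by (intro exI[of _ "\<lambda>z. f' z * g z + g' z * f z"]) auto
qed

lemma partial_deriv_eqI:
  assumes "\<And>z. ((\<lambda>h. p (z + h *\<^sub>R b)) has_field_derivative p' z) (at 0)"
  shows "partial_deriv b p = p'"
  using assms by (auto simp: partial_deriv_def DERIV_imp_deriv)

lemma real_polynomial_function_partial_deriv [intro]:
  "real_polynomial_function p \<Longrightarrow> real_polynomial_function (partial_deriv b p)"
  using polynomial_has_partial_deriv_at_0[of p b] partial_deriv_eqI[of p b] by metis

lemma polynomial_has_partial_deriv_at:
  assumes "real_polynomial_function p"
  shows "((\<lambda>h. p (z + h *\<^sub>R b)) has_field_derivative partial_deriv b p (z + h *\<^sub>R b)) (at h)"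
proof -
  have "((\<lambda>k. p ((z + h *\<^sub>R b) + k *\<^sub>R b)) has_field_derivative partial_deriv b p (z + h *\<^sub>R b)) (at 0)"
    using polynomial_has_partial_deriv_at_0[OF assms, of b] partial_deriv_eqI[of p b] by metis
  then show ?thesis
    using DERIV_shift[of "\<lambda>h. p (z + h *\<^sub>R b)" _ 0 h] by (simp add: algebra_simps)
qed

lemma polynomial_has_partial_deriv:
  assumes "real_polynomial_function p"
  shows "((\<lambda>h. p (z + h *\<^sub>R b)) has_field_derivative partial_deriv b p z) (at 0)"
  using polynomial_has_partial_deriv_at[OF assms, of z b 0] by simp

lemma partial_deriv_const: "partial_deriv b (\<lambda>_. c) = (\<lambda>_. 0)"
  by (rule partial_deriv_eqI) auto

lemma partial_deriv_linear:
  assumes "bounded_linear f"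
  shows "partial_deriv b f = (\<lambda>_. f b)"
proof (rule partial_deriv_eqI)
  interpret bounded_linear f by fact
  show "((\<lambda>h. f (z + h *\<^sub>R b)) has_field_derivative f b) (at 0)" for z
    by (auto simp: add scaleR intro!: derivative_eq_intros)
qed

lemma partial_deriv_add:
  assumes "real_polynomial_function f" "real_polynomial_function g"
  shows "partial_deriv b (\<lambda>z. f z + g z) = (\<lambda>z. partial_deriv b f z + partial_deriv b g z)"
  using assms by (intro partial_deriv_eqI DERIV_add polynomial_has_partial_deriv)

lemma partial_deriv_diff:
  assumes "real_polynomial_function f" "real_polynomial_function g"
  shows "partial_deriv b (\<lambda>z. f z - g z) = (\<lambda>z. partial_deriv b f z - partial_deriv b g z)"
  using assms by (intro partial_deriv_eqI DERIV_diff polynomial_has_partial_deriv)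

lemma partial_deriv_mult:
  assumes "real_polynomial_function f" "real_polynomial_function g"
  shows "partial_deriv b (\<lambda>z. f z * g z) = (\<lambda>z. partial_deriv b f z * g z + partial_deriv b g z * f z)"
proof (rule partial_deriv_eqI)
  show "((\<lambda>h. f (z + h *\<^sub>R b) * g (z + h *\<^sub>R b))
      has_field_derivative partial_deriv b f z * g z + partial_deriv b g z * f z) (at 0)" for z
    using DERIV_mult[OF assms[THEN polynomial_has_partial_deriv, of z b]] by simp
qed

lemma partial_deriv_cmult:
  assumes "real_polynomial_function f"
  shows "partial_deriv b (\<lambda>z. c * f z) = (\<lambda>z. c * partial_deriv b f z)"
  using assms by (simp add: partial_deriv_mult partial_deriv_const real_polynomial_function_const mult.commute)

lemma partial_deriv_sum:
  assumes "finite I" "\<And>i. i \<in> I \<Longrightarrow> real_polynomial_function (f i)"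
  shows "partial_deriv b (\<lambda>z. \<Sum>i\<in>I. f i z) = (\<lambda>z. \<Sum>i\<in>I. partial_deriv b (f i) z)"
  using assms by (intro partial_deriv_eqI DERIV_sum polynomial_has_partial_deriv)

text \<open>Induction on the generation of polynomials: derivatives of linear maps are constant, and
  the twice applied Leibniz rule is symmetric in the two directions.\<close>

lemma partial_deriv_commute:
  assumes "real_polynomial_function p"
  shows "partial_deriv a (partial_deriv b p) = partial_deriv b (partial_deriv a p)"
  using assms
proof (induction p)
  case (linear f)
  then show ?case by (simp add: partial_deriv_linear partial_deriv_const)
next
  case (const c)
  then show ?case by (simp add: partial_deriv_const)
next
  case (add f g)
  then show ?case by (simp add: partial_deriv_add real_polynomial_function_partial_deriv)
next
  case (mult f g)
  then show ?case
    by (simp add: partial_deriv_add partial_deriv_mult real_polynomial_function_partial_deriv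
        real_polynomial_function_mult algebra_simps)
qed

lemma heat_op_eq:
  "heat_op u = (\<lambda>z. (\<Sum>j\<in>UNIV. partial_deriv (axis j 1, 0) (partial_deriv (axis j 1, 0) u) z)
      - partial_deriv (0, 1) u z)"
  by (simp add: heat_op_def d_x_def d_t_def fun_eq_iff)

lemma heat_op_add:
  assumes "real_polynomial_function f" "real_polynomial_function g"
  shows "heat_op (\<lambda>z. f z + g z) = (\<lambda>z. heat_op f z + heat_op g z)"
  using assms
  by (simp add: heat_op_eq partial_deriv_add real_polynomial_function_partial_deriv sum.distrib
      algebra_simps)

lemma heat_op_diff:
  assumes "real_polynomial_function f" "real_polynomial_function g"
  shows "heat_op (\<lambda>z. f z - g z) = (\<lambda>z. heat_op f z - heat_op g z)"
  using assms
  by (simp add: heat_op_eq partial_deriv_diff real_polynomial_function_partial_deriv sum_subtractf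
      algebra_simps)

lemma heat_op_cmult:
  assumes "real_polynomial_function f"
  shows "heat_op (\<lambda>z. c * f z) = (\<lambda>z. c * heat_op f z)"
  using assms
  by (simp add: heat_op_eq partial_deriv_cmult real_polynomial_function_partial_deriv
      sum_distrib_left right_diff_distrib)

text \<open>The Laplacian contributes the product of the two space gradients. For caloric
  \<open>P\<close> this leaves \<open>H(P * P) = 2 |\<nabla>P|^2\<close>, the good term in
  Bernstein's method.\<close>

lemma heat_op_mult:
  assumes "real_polynomial_function f" "real_polynomial_function g"
  shows "heat_op (\<lambda>z. f z * g z) = (\<lambda>z. f z * heat_op g z + g z * heat_op f z
    + 2 * (\<Sum>j\<in>UNIV. partial_deriv (axis j 1, 0) f z * partial_deriv (axis j 1, 0) g z))"
  using assms
  by (simp add: heat_op_eq partial_deriv_add partial_deriv_mult real_polynomial_function_partial_deriv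
      real_polynomial_function_mult sum.distrib sum_distrib_left algebra_simps)

text \<open>The heat operator has constant coefficients; hence derivatives of caloric polynomials
  are caloric.\<close>

lemma heat_op_partial_deriv:
  assumes "real_polynomial_function p"
  shows "heat_op (partial_deriv b p) = partial_deriv b (heat_op p)"
  using assms
  by (simp add: heat_op_eq partial_deriv_diff partial_deriv_sum real_polynomial_function_partial_deriv
      real_polynomial_function_sum partial_deriv_commute[of _ b])

lemma heat_jet_polynomial:
  assumes "real_polynomial_function p"
  shows "heat_jet p z (heat_op p z)"
  unfolding heat_jet_def
proof (intro exI conjI allI)
  fix j
  let ?e = "(axis j 1, 0) :: (real^'a) \<times> real"
  show "\<forall>\<^sub>F h in nhds 0. ((\<lambda>h. p (z + h *\<^sub>R (axis j 1, 0)))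
      has_field_derivative partial_deriv (axis j 1, 0) p (z + h *\<^sub>R (axis j 1, 0))) (at h)"
    by (intro always_eventually allI polynomial_has_partial_deriv_at assms)
  show "((\<lambda>h. partial_deriv (axis j 1, 0) p (z + h *\<^sub>R (axis j 1, 0)))
      has_field_derivative partial_deriv (axis j 1, 0) (partial_deriv (axis j 1, 0) p) z) (at 0)"
    by (intro polynomial_has_partial_deriv real_polynomial_function_partial_deriv assms)
next
  show "((\<lambda>h. p (z + h *\<^sub>R (0, 1))) has_field_derivative partial_deriv (0, 1) p z) (at 0)"
    by (intro polynomial_has_partial_deriv assms)
qed (simp add: heat_op_eq)

section \<open>Coordinates and the defining function as polynomials\<close>

lemma bowl_dist_inner:
  "bowl_dist z0 = (\<lambda>z. (snd z - snd z0) - (\<Sum>i\<in>UNIV. (fst z $ i - fst z0 $ i) * (fst z $ i - fst z0 $ i)))"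
  by (simp add: bowl_dist_def fun_eq_iff power2_norm_eq_inner inner_vec_def)

lemma bounded_linear_coord: "bounded_linear (\<lambda>z :: (real^'n::finite) \<times> real. fst z $ i)"
  by (intro bounded_linear_compose[OF bounded_linear_vec_nth] bounded_linear_fst)

lemma real_polynomial_function_coord [intro]:
  "real_polynomial_function (\<lambda>z :: (real^'n::finite) \<times> real. fst z $ i)"
  by (intro real_polynomial_function_linear bounded_linear_coord)

lemma real_polynomial_function_time [intro]:
  "real_polynomial_function (snd :: (real^'n::finite) \<times> real \<Rightarrow> real)"
  by (intro real_polynomial_function_linear bounded_linear_snd)

lemma real_polynomial_function_bowl_dist [intro]: "real_polynomial_function (bowl_dist z0)"
  unfolding bowl_dist_inner
  by (intro real_polynomial_function_diff real_polynomial_function_sum real_polynomial_function_mult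
      real_polynomial_function_const real_polynomial_function_coord real_polynomial_function_time) auto

lemma partial_deriv_bowl_dist_space:
  "partial_deriv (axis j 1, 0) (bowl_dist z0) = (\<lambda>z. - 2 * (fst z $ j - fst z0 $ j))"
proof (rule partial_deriv_eqI)
  fix z :: "(real^'a) \<times> real"
  have *: "(\<lambda>h. bowl_dist z0 (z + h *\<^sub>R (axis j 1, 0))) =
     (\<lambda>h. bowl_dist z0 z - 2 * h * (fst z $ j - fst z0 $ j) - h\<^sup>2)"
  proof
    fix h :: real
    have *: "(norm (x + h *\<^sub>R axis j 1))\<^sup>2 = (norm x)\<^sup>2 + 2 * h * x $ j + h\<^sup>2" for x :: "real^'a"
      unfolding power2_norm_eq_inner
      by (simp add: inner_add_left inner_commute inner_add_right inner_axis inner_axis'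
          power2_eq_square algebra_simps)
    have **: "fst z + h *\<^sub>R axis j 1 - fst z0 = (fst z - fst z0) + h *\<^sub>R axis j 1"
      by simp
    show "bowl_dist z0 (z + h *\<^sub>R (axis j 1, 0)) =
       bowl_dist z0 z - 2 * h * (fst z $ j - fst z0 $ j) - h\<^sup>2"
      by (simp add: bowl_dist_def ** *)
  qed
  show "((\<lambda>h. bowl_dist z0 (z + h *\<^sub>R (axis j 1, 0))) has_field_derivative
      - 2 * (fst z $ j - fst z0 $ j)) (at 0)"
    unfolding * by (auto intro!: derivative_eq_intros)
qed

text \<open>The Laplacian of \<open>- |x - x0|^2\<close> contributes \<open>- 2 N\<close> and the
  time derivative \<open>- 1\<close>. This negative constant is one of the two terms that
  \<open>c\<close> has to absorb in \<open>bernstein_subcaloric\<close>.\<close>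

lemma heat_op_bowl_dist:
  "heat_op (bowl_dist (z0 :: (real^'n::finite) \<times> real)) = (\<lambda>_. - 2 * real CARD('n) - 1)"
proof -
  have 1: "partial_deriv (axis j 1, 0) (\<lambda>z :: (real^'n) \<times> real. 2 * fst z0 $ j - 2 * fst z $ j) = (\<lambda>_. - 2)"
    for j
    by (rule partial_deriv_eqI) (auto intro!: derivative_eq_intros simp: axis_def)
  have 2: "partial_deriv (0, 1) (bowl_dist z0) = (\<lambda>_. 1)"
    by (rule partial_deriv_eqI) (auto intro!: derivative_eq_intros simp: bowl_dist_def)
  show ?thesis
    by (simp add: heat_op_eq partial_deriv_bowl_dist_space 1 2 fun_eq_iff)
qed

section \<open>Gradient estimate for caloric polynomials\<close>

text \<open>Bernstein's method: \<open>d\<^sup>2 v\<^sup>2 + C P\<^sup>2\<close> is subcaloric, where \<open>v\<close> is a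
  space derivative of \<open>P\<close> and \<open>d\<close> vanishes on the normal boundary.\<close>

lemma bernstein_subcaloric:
  fixes z0 :: "(real^'n::finite) \<times> real" and j :: 'n
  assumes P: "real_polynomial_function P" "heat_op P = (\<lambda>_. 0)"
    and z: "0 \<le> bowl_dist z0 z" "snd z \<le> T"
    and c: "12 * (T - snd z0) + (2 * real CARD('n) + 1) * (T - snd z0) \<le> c"
  defines "v \<equiv> partial_deriv (axis j 1, 0) P"
  shows "0 \<le> heat_op (\<lambda>z. (bowl_dist z0 z * v z) * (bowl_dist z0 z * v z) + c * (P z * P z)) z"
proof -
  let ?D = "\<lambda>i. partial_deriv ((axis i 1, 0) :: (real^'n) \<times> real)"
  let ?d = "bowl_dist z0"
  let ?N = "real CARD('n)"
  let ?R = "T - snd z0"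
  note rp = real_polynomial_function_mult real_polynomial_function_bowl_dist
    real_polynomial_function_partial_deriv real_polynomial_function_const
  have v: "real_polynomial_function v" "heat_op v = (\<lambda>_. 0)"
    using P by (auto simp: v_def heat_op_partial_deriv partial_deriv_const)
  define b where "b i = ?D i ?d z" for i
  define a where "a i = ?D i v z" for i
  define S where "S = (\<Sum>i\<in>UNIV. (b i)\<^sup>2)"
  have S: "S = 4 * (norm (fst z - fst z0))\<^sup>2"
    unfolding power2_norm_eq_inner S_def b_def partial_deriv_bowl_dist_space
    by (simp add: inner_vec_def sum_distrib_left power2_eq_square algebra_simps)
  have dR: "?d z \<le> ?R" "(norm (fst z - fst z0))\<^sup>2 \<le> ?R" "0 \<le> ?R"
    using z zero_le_power2[of "norm (fst z - fst z0)"] unfolding bowl_dist_def by linarith+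
  \<comment> \<open>Origin of the 12 in the bound for \<open>c\<close>: \<open>3 * S\<close> is 12
    times the squared space distance.\<close>
  have SR: "3 * S \<le> 12 * ?R" using dR S by simp
  have dn: "(2 * ?N + 1) * ?d z \<le> (2 * ?N + 1) * ?R" using dR by (intro mult_left_mono) auto
  \<comment> \<open>Since \<open>H v = 0\<close>, \<open>H(d v) = v H d + 2 a.b\<close>. Apart from
    the \<open>H d\<close> term, \<open>H((d v)^2)\<close> is
    \<open>4 d v a.b + 2 |d a + v b|^2\<close>, and completing the square turns this into
    \<open>2 |d a + 2 v b|^2 - 6 S v^2\<close>.\<close>
  have "heat_op (\<lambda>z. (?d z * v z) * (?d z * v z)) z =
      2 * (\<Sum>i\<in>UNIV. (?d z * a i + 2 * v z * b i)\<^sup>2) - 2 * ((2 * ?N + 1) * ?d z + 3 * S) * (v z)\<^sup>2"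
    using v unfolding S_def
    by (simp add: heat_op_mult heat_op_bowl_dist partial_deriv_mult rp a_def[symmetric] b_def[symmetric],
        simp add: power2_eq_square algebra_simps sum.distrib sum_distrib_left,
        simp add: algebra_simps flip: sum.distrib)
  moreover have "heat_op (\<lambda>z. c * (P z * P z)) z = 2 * c * (\<Sum>i\<in>UNIV. (?D i P z)\<^sup>2)"
    using P by (simp add: heat_op_cmult heat_op_mult rp power2_eq_square)
  moreover have "heat_op (\<lambda>z. (?d z * v z) * (?d z * v z) + c * (P z * P z)) z =
     heat_op (\<lambda>z. (?d z * v z) * (?d z * v z)) z + heat_op (\<lambda>z. c * (P z * P z)) z"
    using P v by (subst heat_op_add) (auto intro!: rp)
  moreover have "((2 * ?N + 1) * ?d z + 3 * S) * (v z)\<^sup>2 \<le> c * (v z)\<^sup>2"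
  proof (rule mult_right_mono)
    show "(2 * ?N + 1) * ?d z + 3 * S \<le> c" using SR dn c by linarith
  qed simp
  \<comment> \<open>As \<open>v\<close> is one component of the space gradient,
    \<open>H(c P^2) = 2 c |\<nabla>P|^2\<close> dominates the negative multiple of
    \<open>v^2\<close>.\<close>
  moreover have "(v z)\<^sup>2 \<le> (\<Sum>i\<in>UNIV. (?D i P z)\<^sup>2)"
    unfolding v_def by (rule member_le_sum[of j UNIV "\<lambda>i. (?D i P z)\<^sup>2"]) auto
  then have "c * (v z)\<^sup>2 \<le> c * (\<Sum>i\<in>UNIV. (?D i P z)\<^sup>2)"
    by (rule mult_left_mono) (rule order_trans[OF _ c], use dR in simp)
  moreover have "0 \<le> (\<Sum>i\<in>UNIV. (?d z * a i + 2 * v z * b i)\<^sup>2)"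
    by (intro sum_nonneg) auto
  ultimately show ?thesis by linarith
qed

text \<open>Where \<open>d = 0\<close>, \<open>w = d^2 v^2 + c P^2\<close> reduces to
  \<open>c P^2\<close>, so the maximum principle gives \<open>d^2 v^2 \<le> w \<le> c M^2\<close>.
  The constant is fixed before \<open>P\<close>, \<open>M\<close> and \<open>j\<close>, as the
  application to differences of a Cauchy sequence demands.\<close>

lemma caloric_polynomial_gradient_bound:
  fixes z0 :: "(real^'n::finite) \<times> real"
  obtains C where "C \<ge> 0"
    "\<And>P M j z. real_polynomial_function P \<Longrightarrow> heat_op P = (\<lambda>_. 0) \<Longrightarrow>
       (\<And>y. 0 \<le> bowl_dist z0 y \<Longrightarrow> snd y < T \<Longrightarrow> \<bar>P y\<bar> \<le> M) \<Longrightarrow>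
       0 \<le> bowl_dist z0 z \<Longrightarrow> snd z < T \<Longrightarrow>
       bowl_dist z0 z * \<bar>partial_deriv (axis j 1, 0) P z\<bar> \<le> C * M"
proof (cases "snd z0 < T")
  \<comment> \<open>The region is empty here, so any constant will do.\<close>
  case False
  then have "\<not> (0 \<le> bowl_dist z0 z \<and> snd z < T)" for z
    using bowl_dist_bounded(1)[of z0 z "snd z"] by auto
  then show ?thesis using that[of 0] by blast
next
  case True
  define c where "c = 12 * (T - snd z0) + (2 * real CARD('n) + 1) * (T - snd z0)"
  have c: "c > 0" using True by (auto simp: c_def intro!: add_pos_nonneg)
  show ?thesis
  proof (rule that[of "sqrt c"])
    show "sqrt c \<ge> 0" using c by simp
    fix P M j z
    assume P: "real_polynomial_function P" "heat_op P = (\<lambda>_. 0)"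
      and M: "\<And>y. 0 \<le> bowl_dist z0 y \<Longrightarrow> snd y < T \<Longrightarrow> \<bar>P y\<bar> \<le> M"
      and z: "0 \<le> bowl_dist z0 z" "snd z < T"
    define v where "v = partial_deriv (axis j 1, 0) P"
    define w where "w = (\<lambda>z. (bowl_dist z0 z * v z) * (bowl_dist z0 z * v z) + c * (P z * P z))"
    have M0: "0 \<le> M" using M[OF z] by simp
    have w: "real_polynomial_function w"
      unfolding w_def v_def using P
      by (intro real_polynomial_function.intros(3) real_polynomial_function_mult
          real_polynomial_function_const real_polynomial_function_partial_deriv) auto
    have "w z \<le> c * M\<^sup>2"
    proof (rule weak_max_principle[of z0 T w])
      show "continuous_on {z. 0 \<le> bowl_dist z0 z \<and> snd z < T} w"
        using w by (simp add: continuous_on_polymonial_function real_polynomial_function_eq)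
      show "\<exists>L\<ge>0. heat_jet w z L" if "0 < bowl_dist z0 z" "snd z < T" for z
        using heat_jet_polynomial[OF w, of z] bernstein_subcaloric[OF P, of z0 z T c j] that
        unfolding w_def v_def c_def by auto
      show "w y \<le> c * M\<^sup>2" if "bowl_dist z0 y = 0" "snd y < T" for y
        using M[of y] that c by (auto simp: w_def power2_eq_square[symmetric] intro!: abs_le_square_iff[THEN iffD1])
    qed (use z in auto)
    moreover have "0 \<le> c * (P z * P z)" using c by simp
    ultimately have "(bowl_dist z0 z * v z)\<^sup>2 \<le> c * M\<^sup>2"
      by (simp add: w_def power2_eq_square)
    then have "\<bar>bowl_dist z0 z * v z\<bar> \<le> sqrt (c * M\<^sup>2)"
      by (metis real_sqrt_abs real_sqrt_le_iff)
    then show "bowl_dist z0 z * \<bar>partial_deriv (axis j 1, 0) P z\<bar> \<le> sqrt c * M"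
      using z M0 by (simp add: abs_mult real_sqrt_mult v_def)
  qed
qed

section \<open>Maximum principle for caloric polynomials, and two algebraic tools\<close>

lemma caloric_polynomial_max:
  assumes P: "real_polynomial_function P" "heat_op P = (\<lambda>_. 0)"
    and M: "\<And>y. bowl_dist z0 y = 0 \<Longrightarrow> snd y < T \<Longrightarrow> P y \<le> M"
    and z: "0 \<le> bowl_dist z0 z" "snd z < T"
  shows "P z \<le> M"
proof (rule weak_max_principle[OF _ _ M z])
  show "continuous_on {z. 0 \<le> bowl_dist z0 z \<and> snd z < T} P"
    using P by (simp add: continuous_on_polymonial_function real_polynomial_function_eq)
  show "\<exists>L\<ge>0. heat_jet P z L" for z
    using heat_jet_polynomial[OF P(1), of z] P(2) by auto
qed

lemma caloric_polynomial_abs_max: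
  assumes P: "real_polynomial_function P" "heat_op P = (\<lambda>_. 0)"
    and M: "\<And>y. bowl_dist z0 y = 0 \<Longrightarrow> snd y < T \<Longrightarrow> \<bar>P y\<bar> \<le> M"
    and z: "0 \<le> bowl_dist z0 z" "snd z < T"
  shows "\<bar>P z\<bar> \<le> M"
proof -
  have "P z \<le> M"
    using M by (intro caloric_polynomial_max[OF P _ z]) (auto simp: abs_le_iff)
  \<comment> \<open>Negation is written as a multiple by \<open>- 1\<close> to fit
    \<open>heat_op_cmult\<close>.\<close>
  moreover have "real_polynomial_function (\<lambda>z. - 1 * P z)" "heat_op (\<lambda>z. - 1 * P z) = (\<lambda>_. 0)"
    using P by (auto simp only: heat_op_cmult intro!: real_polynomial_function_mult real_polynomial_function_const)
  then have "- 1 * P z \<le> M"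
    by (rule caloric_polynomial_max[OF _ _ _ z]) (use M in \<open>auto simp: abs_le_iff\<close>)
  ultimately show ?thesis by simp
qed

text \<open>On the line \<open>l\<close> with \<open>l 0 = y\<close> and \<open>l 1 = z\<close>,
  \<open>q\<close> is a univariate polynomial with infinitely many zeros near 0, hence zero at
  1.\<close>

lemma real_polynomial_function_zero_on_open:
  fixes q :: "'a::real_normed_vector \<Rightarrow> real"
  assumes q: "real_polynomial_function q" and U: "open U" "y \<in> U" "\<And>z. z \<in> U \<Longrightarrow> q z = 0"
  shows "q z = 0"
proof -
  define l where "l = (\<lambda>s::real. y + s *\<^sub>R (z - y))"
  have "polynomial_function l"
    unfolding l_def
    by (intro polynomial_function_add polynomial_function_const polynomial_function_bounded_linear
        bounded_linear_scaleR_left)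
  then have "real_polynomial_function (q \<circ> l)" using q by auto
  then obtain a n where a: "q \<circ> l = (\<lambda>x. \<Sum>i\<le>n. a i * x ^ i)"
    using real_polynomial_function_imp_sum by blast
  have "isCont l 0" unfolding l_def by (intro continuous_intros)
  then have "\<forall>\<^sub>F s in at 0. l s \<in> U"
    using U by (intro topological_tendstoD[of l "l 0"]) (auto simp: isCont_def l_def)
  then obtain e where e: "e > 0" "\<And>s. s \<noteq> 0 \<Longrightarrow> \<bar>s\<bar> < e \<Longrightarrow> l s \<in> U"
    unfolding eventually_at by (auto simp: dist_real_def)
  have "{0<..<e} \<subseteq> {x. (\<Sum>i\<le>n. a i * x ^ i) = 0}"
  proof
    fix s assume "s \<in> {0<..<e}"
    then have "(q \<circ> l) s = 0" using e(2)[of s] U(3) by auto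
    then show "s \<in> {x. (\<Sum>i\<le>n. a i * x ^ i) = 0}" unfolding a by simp
  qed
  then have "infinite {x. (\<Sum>i\<le>n. a i * x ^ i) = 0}"
    using e(1) infinite_Ioo[of 0 e] finite_subset by blast
  then have "a i = 0" if "i \<le> n" for i
    using Transcendental.polyfun_rootbound[of a i n] that by auto
  then have "(q \<circ> l) 1 = 0" unfolding a by simp
  then show ?thesis by (simp add: l_def)
qed

text \<open>Dimension count: the image of a basis is independent of full size, hence spans.
  Linearity is asked on \<open>S\<close> only, because \<open>heat_op\<close> is shown to be linear
  on polynomials only; the finite set \<open>F\<close> carries the finite dimension of
  \<open>S\<close> within an infinite-dimensional function space.\<close>

lemma (in vector_space) injective_endomorphism_surj:
  assumes S: "subspace S" "finite F" "S \<subseteq> span F"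
    and T: "\<And>v. v \<in> S \<Longrightarrow> T v \<in> S"
      "\<And>v w. v \<in> S \<Longrightarrow> w \<in> S \<Longrightarrow> T (v + w) = T v + T w"
      "\<And>r v. v \<in> S \<Longrightarrow> T (scale r v) = scale r (T v)"
      "\<And>v. v \<in> S \<Longrightarrow> T v = 0 \<Longrightarrow> v = 0"
    and y: "y \<in> S"
  shows "\<exists>x\<in>S. T x = y"
proof -
  interpret vector_space_pair scale scale ..
  obtain B where B: "B \<subseteq> S" "independent B" "S \<subseteq> span B"
    by (rule maximal_independent_subset)
  have fin: "finite B"
    using independent_span_bound[OF S(2) B(2)] B(1) S(3) by blast
  have span_B: "span B = S"
    using B S(1) by (meson span_minimal subset_antisym)
  \<comment> \<open>The values of \<open>T\<close> on the basis extend to a globally linear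
    \<open>g\<close>, which agrees with \<open>T\<close> on \<open>S\<close>.\<close>
  obtain g where g: "Vector_Spaces.linear scale scale g" "\<And>x. x \<in> B \<Longrightarrow> g x = T x"
    using linear_independent_extend[OF B(2), of T] by blast
  interpret g: Vector_Spaces.linear scale scale g by fact
  have T0: "T 0 = 0" using T(3)[of 0 0] subspace_0[OF S(1)] by simp
  have gT: "x \<in> S \<and> g x = T x" if "x \<in> span B" for x
    using that
  proof (induction rule: span_induct_alt)
    case base
    then show ?case using T0 subspace_0[OF S(1)] by (simp add: g.zero)
  next
    case (step c x y)
    then show ?case
      using B(1) g(2) T(2,3) subspace_add[OF S(1)] subspace_scale[OF S(1)]
      by (auto simp: g.add g.scale)
  qed
  have inj: "inj_on g (span B)"
    using gT T(4) by (subst g.inj_on_iff_eq_0[OF subspace_span]) auto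
  have ind: "independent (g ` B)"
    by (rule linear_independent_injective_image[OF g(1) B(2) inj])
  have sub: "g ` B \<subseteq> span B"
    using gT T(1) B(1) span_B by (metis image_subset_iff span_base)
  obtain t' where t': "card t' = card B" "finite t'" "g ` B \<subseteq> t'" "t' \<subseteq> g ` B \<union> B" "g ` B \<subseteq> span t'"
    using exchange_lemma[OF fin ind sub] by blast
  have card: "card (g ` B) = card B"
    using inj span_superset by (intro card_image) (blast intro: inj_on_subset)
  \<comment> \<open>A vector of \<open>B\<close> outside this span would give an independent set of
    \<open>card B + 1\<close> vectors in \<open>span B\<close>.\<close>
  have "B \<subseteq> span (g ` B)"
  proof
    fix b assume b: "b \<in> B"
    show "b \<in> span (g ` B)"
    proof (rule ccontr)
      assume nb: "b \<notin> span (g ` B)"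
      then have "independent (insert b (g ` B))" using ind by (simp add: independent_insert)
      moreover have "insert b (g ` B) \<subseteq> span B" using b sub span_base by auto
      ultimately have "card (insert b (g ` B)) \<le> card B"
        using independent_span_bound[OF fin] by blast
      moreover have "b \<notin> g ` B" using nb span_base by blast
      ultimately show False using card fin by simp
    qed
  qed
  then have "y \<in> span (g ` B)" using y span_B span_mono span_span by blast
  then have "y \<in> g ` span B" using g.span_image by simp
  then show ?thesis using gT by auto
qed

section \<open>Caloric polynomials with prescribed boundary values\<close>

interpretation fun_space: vector_space "\<lambda>(c::real) (f :: 'a \<Rightarrow> real) z. c * f z"
  by standard (auto simp: fun_eq_iff algebra_simps)

text \<open>A word denotes a product of coordinates: \<open>Some j\<close> stands for \<open>x\<^sub>j\<close> and \<open>None\<close> for \<open>t\<close>,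
  which has parabolic weight 2. Weights are integers so that \<open>polys_upto m = {0}\<close> for negative \<open>m\<close>, and
  differentiation lowers the degree without a case distinction.\<close>

fun monomial :: "'n::finite option list \<Rightarrow> (real^'n) \<times> real \<Rightarrow> real" where
  "monomial [] = (\<lambda>z. 1)"
| "monomial (Some j # w) = (\<lambda>z. fst z $ j * monomial w z)"
| "monomial (None # w) = (\<lambda>z. snd z * monomial w z)"

fun weight :: "'n option list \<Rightarrow> int" where
  "weight [] = 0"
| "weight (Some j # w) = 1 + weight w"
| "weight (None # w) = 2 + weight w"

definition polys_upto :: "int \<Rightarrow> ((real^'n::finite) \<times> real \<Rightarrow> real) set" where
  "polys_upto m = fun_space.span (monomial ` {w. weight w \<le> m})"

text \<open>Each letter weighs at least 1, so the weight bounds the length of a word over a finite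
  alphabet. This makes \<open>polys_upto m\<close> finite-dimensional.\<close>

lemma finite_weight_le: "finite {w :: 'n::finite option list. weight w \<le> m}"
proof (rule finite_subset)
  have *: "int (length w) \<le> weight w" for w :: "'n option list"
    by (induction w rule: weight.induct) auto
  show "{w :: 'n option list. weight w \<le> m} \<subseteq> {w. set w \<subseteq> UNIV \<and> length w \<le> nat m}"
  proof (rule subsetI)
    fix w :: "'n option list" assume "w \<in> {w. weight w \<le> m}"
    with *[of w] have "length w \<le> nat m" by simp
    then show "w \<in> {w. set w \<subseteq> UNIV \<and> length w \<le> nat m}" by simp
  qed
  show "finite {w :: 'n option list. set w \<subseteq> UNIV \<and> length w \<le> nat m}"
    by (rule finite_lists_length_le) simp
qed

lemma polys_upto_mono: "m \<le> n \<Longrightarrow> f \<in> polys_upto m \<Longrightarrow> f \<in> polys_upto n"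
  unfolding polys_upto_def by (erule subsetD[rotated], intro fun_space.span_mono) auto

lemma polys_upto_monomial: "weight w \<le> m \<Longrightarrow> monomial w \<in> polys_upto m"
  unfolding polys_upto_def by (intro fun_space.span_base) auto

lemma polys_upto_add: "f \<in> polys_upto m \<Longrightarrow> g \<in> polys_upto m \<Longrightarrow> (\<lambda>z. f z + g z) \<in> polys_upto m"
  using fun_space.span_add[of f _ g] by (simp add: polys_upto_def plus_fun_def)

lemma polys_upto_cmult: "f \<in> polys_upto m \<Longrightarrow> (\<lambda>z. c * f z) \<in> polys_upto m"
  unfolding polys_upto_def by (rule fun_space.span_scale)

lemma polys_upto_zero: "(\<lambda>z. 0) \<in> polys_upto m"
  using fun_space.span_zero by (simp add: polys_upto_def zero_fun_def)

lemma polys_upto_sum: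
  "finite I \<Longrightarrow> (\<And>i. i \<in> I \<Longrightarrow> f i \<in> polys_upto m) \<Longrightarrow> (\<lambda>z. \<Sum>i\<in>I. f i z) \<in> polys_upto m"
  by (induction I rule: finite_induct) (auto simp: polys_upto_zero intro: polys_upto_add)

text \<open>Span induction in pointwise form. Membership of \<open>g\<close> is carried along, so
  that the step may use that \<open>g\<close> is a polynomial.\<close>

lemma polys_upto_induct [consumes 1, case_names zero step]:
  assumes "f \<in> polys_upto m" and "P (\<lambda>z. 0)"
    and "\<And>c w g. weight w \<le> m \<Longrightarrow> g \<in> polys_upto m \<Longrightarrow> P g \<Longrightarrow> P (\<lambda>z. c * monomial w z + g z)"
  shows "P f"
proof -
  have "f \<in> polys_upto m \<and> P f"
    using assms(1) unfolding polys_upto_def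
  proof (induction rule: fun_space.span_induct_alt)
    case base
    then show ?case using assms(2) fun_space.span_zero by (simp add: zero_fun_def)
  next
    case (step c x y)
    then obtain w where w: "x = monomial w" "weight w \<le> m" by auto
    have "(\<lambda>z. c * monomial w z + y z) \<in> polys_upto m"
      using step w
      by (intro polys_upto_add polys_upto_cmult polys_upto_monomial) (simp_all add: polys_upto_def)
    with step w assms(3)[of w y c] show ?case by (simp add: polys_upto_def plus_fun_def)
  qed
  then show ?thesis ..
qed

section \<open>Parabolic degree under products and derivatives\<close>

lemma real_polynomial_function_monomial [intro]: "real_polynomial_function (monomial w)"
  by (induction w rule: monomial.induct)
    (auto intro!: real_polynomial_function_mult real_polynomial_function_const)

lemma polys_upto_polynomial: "f \<in> polys_upto m \<Longrightarrow> real_polynomial_function f"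
  by (induction rule: polys_upto_induct)
    (intro real_polynomial_function.intros(3) real_polynomial_function_mult
      real_polynomial_function_const real_polynomial_function_monomial; assumption)+

lemma monomial_append: "monomial (v @ w) = (\<lambda>z. monomial v z * monomial w z)"
  by (induction v rule: monomial.induct) (auto simp: mult.assoc)

lemma weight_append: "weight (v @ w) = weight v + weight w"
  by (induction v rule: weight.induct) auto

text \<open>By bilinearity it suffices to multiply monomials, where words are concatenated and
  weights add.\<close>

lemma polys_upto_mult:
  assumes "f \<in> polys_upto m" "g \<in> polys_upto n"
  shows "(\<lambda>z. f z * g z) \<in> polys_upto (m + n)"
  using assms
proof (induction rule: polys_upto_induct)
  case zero
  then show ?case by (simp add: polys_upto_zero)
next
  case (step c v f)
  have "(\<lambda>z. monomial v z * g z) \<in> polys_upto (m + n)"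
    using step(4)
  proof (induction rule: polys_upto_induct)
    case zero
    then show ?case by (simp add: polys_upto_zero)
  next
    case (step d w g)
    have "(\<lambda>z. d * monomial (v @ w) z + monomial v z * g z) \<in> polys_upto (m + n)"
      using step \<open>weight v \<le> m\<close>
      by (intro polys_upto_add polys_upto_cmult polys_upto_monomial) (auto simp: weight_append)
    then show ?case by (simp add: monomial_append algebra_simps)
  qed
  then have "(\<lambda>z. c * (monomial v z * g z) + f z * g z) \<in> polys_upto (m + n)"
    using step by (intro polys_upto_add polys_upto_cmult) auto
  then show ?case by (simp add: algebra_simps)
qed

text \<open>Leibniz's rule at the first letter: either that letter is differentiated away, or the
  derivative falls on the rest and the letter restores its own weight.\<close>

lemma partial_deriv_monomial_space:
  "partial_deriv (axis j 1, 0) (monomial w) \<in> polys_upto (weight w - 1)"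
proof (induction w rule: monomial.induct)
  case 1
  then show ?case by (simp add: partial_deriv_const polys_upto_zero)
next
  case (2 i w)
  \<comment> \<open>\<open>axis j 1 $ i\<close> is the Kronecker delta, so equal and distinct
    indices need no separate cases.\<close>
  have "partial_deriv (axis j 1, 0) (monomial (Some i # w)) =
     (\<lambda>z. axis j 1 $ i * monomial w z + monomial [Some i] z * partial_deriv (axis j 1, 0) (monomial w) z)"
    by (simp add: partial_deriv_mult real_polynomial_function_coord real_polynomial_function_monomial
        partial_deriv_linear[OF bounded_linear_coord] mult.commute add.commute)
  moreover have "(\<lambda>z. monomial [Some i] z * partial_deriv (axis j 1, 0) (monomial w) z)
      \<in> polys_upto (1 + (weight w - 1))"
    using 2 by (intro polys_upto_mult polys_upto_monomial) auto
  ultimately show ?case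
    by (auto intro!: polys_upto_add polys_upto_cmult polys_upto_monomial)
next
  case (3 w)
  have "partial_deriv (axis j 1, 0) (monomial (None # w)) =
     (\<lambda>z. monomial [None] z * partial_deriv (axis j 1, 0) (monomial w) z)"
    by (simp add: partial_deriv_mult real_polynomial_function_time real_polynomial_function_monomial
        partial_deriv_linear[OF bounded_linear_snd] mult.commute)
  moreover have "(\<lambda>z. monomial [None] z * partial_deriv (axis j 1, 0) (monomial w) z)
      \<in> polys_upto (2 + (weight w - 1))"
    using 3 by (intro polys_upto_mult polys_upto_monomial) auto
  ultimately show ?case by (simp add: algebra_simps)
qed

lemma partial_deriv_monomial_time:
  "partial_deriv (0, 1) (monomial w) \<in> polys_upto (weight w - 2)"
proof (induction w rule: monomial.induct)
  case 1
  then show ?case by (simp add: partial_deriv_const polys_upto_zero)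
next
  case (2 i w)
  have "partial_deriv (0, 1) (monomial (Some i # w)) =
     (\<lambda>z. monomial [Some i] z * partial_deriv (0, 1) (monomial w) z)"
    by (simp add: partial_deriv_mult real_polynomial_function_coord real_polynomial_function_monomial
        partial_deriv_linear[OF bounded_linear_coord] mult.commute)
  moreover have "(\<lambda>z. monomial [Some i] z * partial_deriv (0, 1) (monomial w) z)
      \<in> polys_upto (1 + (weight w - 2))"
    using 2 by (intro polys_upto_mult polys_upto_monomial) auto
  ultimately show ?case by (simp add: algebra_simps)
next
  case (3 w)
  have "partial_deriv (0, 1) (monomial (None # w)) =
     (\<lambda>z. monomial w z + monomial [None] z * partial_deriv (0, 1) (monomial w) z)"
    by (simp add: partial_deriv_mult real_polynomial_function_time real_polynomial_function_monomial
        partial_deriv_linear[OF bounded_linear_snd] mult.commute)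
  moreover have "(\<lambda>z. monomial [None] z * partial_deriv (0, 1) (monomial w) z)
      \<in> polys_upto (2 + (weight w - 2))"
    using 3 by (intro polys_upto_mult polys_upto_monomial) auto
  ultimately show ?case
    by (auto intro!: polys_upto_add polys_upto_monomial)
qed

lemma polys_upto_partial_deriv:
  assumes "f \<in> polys_upto m"
    and "\<And>w. partial_deriv b (monomial w) \<in> polys_upto (weight w - k)"
  shows "partial_deriv b f \<in> polys_upto (m - k)"
  using assms(1)
proof (induction rule: polys_upto_induct)
  case zero
  then show ?case by (simp add: partial_deriv_const polys_upto_zero)
next
  case (step c w g)
  have "partial_deriv b (\<lambda>z. c * monomial w z + g z) =
      (\<lambda>z. c * partial_deriv b (monomial w) z + partial_deriv b g z)"
    using step(2)
    by (simp add: partial_deriv_add partial_deriv_cmult real_polynomial_function_mult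
        real_polynomial_function_const real_polynomial_function_monomial polys_upto_polynomial)
  moreover have "partial_deriv b (monomial w) \<in> polys_upto (m - k)"
    using step(1) by (intro polys_upto_mono[OF _ assms(2)]) simp
  ultimately show ?case
    using step by (simp add: polys_upto_add polys_upto_cmult)
qed

lemma polys_upto_heat_op:
  assumes "f \<in> polys_upto m"
  shows "heat_op f \<in> polys_upto (m - 2)"
proof -
  have "partial_deriv (axis j 1, 0) (partial_deriv (axis j 1, 0) f) \<in> polys_upto (m - 1 - 1)" for j
    by (intro polys_upto_partial_deriv[OF _ partial_deriv_monomial_space] assms)
  moreover have "(\<lambda>z. - 1 * partial_deriv (0, 1) f z) \<in> polys_upto (m - 2)"
    by (intro polys_upto_cmult polys_upto_partial_deriv[OF _ partial_deriv_monomial_time] assms)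
  ultimately have "(\<lambda>z. (\<Sum>j\<in>UNIV. partial_deriv (axis j 1, 0) (partial_deriv (axis j 1, 0) f) z) +
     - 1 * partial_deriv (0, 1) f z) \<in> polys_upto (m - 2)"
    by (intro polys_upto_add polys_upto_sum) auto
  then show ?thesis by (simp add: heat_op_eq)
qed

lemma polys_upto_coord: "(\<lambda>z. fst z $ j) \<in> polys_upto 1"
  using polys_upto_monomial[of "[Some j]" 1] by simp

lemma polys_upto_time: "snd \<in> polys_upto 2"
  using polys_upto_monomial[of "[None]" 2] by simp

lemma polys_upto_const: "0 \<le> m \<Longrightarrow> (\<lambda>z. c) \<in> polys_upto m"
  using polys_upto_cmult[OF polys_upto_monomial[of "[]" m], of c] by simp

lemma polys_upto_diff:
  assumes "f \<in> polys_upto m" "g \<in> polys_upto m"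
  shows "(\<lambda>z. f z - g z) \<in> polys_upto m"
  using polys_upto_add[OF assms(1) polys_upto_cmult[OF assms(2), of "- 1"]] by simp

text \<open>Giving \<open>t\<close> weight 2 puts both parts of \<open>d\<close> in degree 2. Thus
  multiplication by \<open>d\<close> raises the degree by exactly as much as \<open>heat_op\<close>
  lowers it.\<close>

lemma polys_upto_bowl_dist: "bowl_dist z0 \<in> polys_upto 2"
proof -
  have "(\<lambda>z. (fst z $ i - fst z0 $ i) * (fst z $ i - fst z0 $ i)) \<in> polys_upto (1 + 1)" for i
    by (intro polys_upto_mult polys_upto_diff polys_upto_coord polys_upto_const) auto
  then show ?thesis
    unfolding bowl_dist_inner
    by (intro polys_upto_diff polys_upto_sum polys_upto_time polys_upto_const) auto
qed

text \<open>Keeping \<open>m\<close> nonnegative lets \<open>m + n\<close> bound both degrees in the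
  sum case.\<close>

lemma real_polynomial_function_in_polys_upto:
  assumes "real_polynomial_function p"
  shows "\<exists>m\<ge>0. p \<in> polys_upto m"
  using assms
proof (induction p)
  case (linear f)
  interpret bounded_linear f by fact
  have "f z = (\<Sum>j\<in>UNIV. f (axis j 1, 0) * fst z $ j) + f (0, 1) * snd z" for z
  proof -
    have "z = (\<Sum>j\<in>UNIV. (fst z $ j) *\<^sub>R (axis j 1, 0)) + snd z *\<^sub>R (0, 1)"
      by (rule prod_eqI) (simp_all add: fst_sum snd_sum vec_eq_iff axis_def if_distrib sum.If_cases cong: if_cong)
    then have "f z = f ((\<Sum>j\<in>UNIV. (fst z $ j) *\<^sub>R (axis j 1, 0)) + snd z *\<^sub>R (0, 1))" by simp
    then show ?thesis unfolding add scaleR sum by (simp add: mult.commute)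
  qed
  then have "f = (\<lambda>z. (\<Sum>j\<in>UNIV. f (axis j 1, 0) * fst z $ j) + f (0, 1) * snd z)" by (rule ext)
  also have "\<dots> \<in> polys_upto 2"
    by (intro polys_upto_add polys_upto_sum polys_upto_cmult polys_upto_time
        polys_upto_mono[OF _ polys_upto_coord]) auto
  finally show ?case by (intro exI[of _ 2]) simp
next
  case (const c)
  show ?case using polys_upto_const[of 0 c] by auto
next
  case (add f g)
  then obtain m n where "0 \<le> m" "f \<in> polys_upto m" "0 \<le> n" "g \<in> polys_upto n" by blast
  then have "(\<lambda>z. f z + g z) \<in> polys_upto (m + n)"
    by (intro polys_upto_add polys_upto_mono[OF _ \<open>f \<in> polys_upto m\<close>]
        polys_upto_mono[OF _ \<open>g \<in> polys_upto n\<close>]) auto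
  then show ?case using \<open>0 \<le> m\<close> \<open>0 \<le> n\<close> by (intro exI[of _ "m + n"]) simp
next
  case (mult f g)
  then obtain m n where "0 \<le> m" "f \<in> polys_upto m" "0 \<le> n" "g \<in> polys_upto n" by blast
  then show ?case using polys_upto_mult[of f m g n] by (intro exI[of _ "m + n"]) simp
qed

text \<open>Injectivity of \<open>q \<mapsto> H(d q)\<close>. The caloric polynomial
  \<open>d q\<close> vanishes on \<open>d = 0\<close>, hence inside a bowl; dividing by
  \<open>d > 0\<close> gives \<open>q = 0\<close> on an open set, and so everywhere. The opening 1
  of that bowl is arbitrary.\<close>

lemma heat_op_bowl_dist_mult_eq_0:
  fixes z0 :: "(real^'n::finite) \<times> real"
  assumes q: "real_polynomial_function q" and h: "heat_op (\<lambda>z. bowl_dist z0 z * q z) = (\<lambda>_. 0)"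
  shows "q = (\<lambda>_. 0)"
proof
  fix z
  let ?U = "{z. 0 < bowl_dist z0 z \<and> snd z < snd z0 + 1}"
  have "open ?U"
    by (intro open_Collect_conj open_Collect_less continuous_intros)
  moreover have "(fst z0, snd z0 + 1/2) \<in> ?U" by (simp add: bowl_dist_def)
  moreover have "q y = 0" if "y \<in> ?U" for y
  proof -
    have "\<bar>bowl_dist z0 y * q y\<bar> \<le> 0"
    proof (rule caloric_polynomial_abs_max[OF _ h, of z0 "snd z0 + 1"])
      show "real_polynomial_function (\<lambda>z. bowl_dist z0 z * q z)"
        by (rule real_polynomial_function_mult[OF real_polynomial_function_bowl_dist q])
    qed (use that in auto)
    then show ?thesis using that by auto
  qed
  ultimately show "q z = 0" by (rule real_polynomial_function_zero_on_open[OF q])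
qed

lemma caloric_polynomial_extension:
  fixes z0 :: "(real^'n::finite) \<times> real"
  assumes p: "real_polynomial_function p"
  obtains P where "real_polynomial_function P" "heat_op P = (\<lambda>_. 0)"
    "\<And>z. bowl_dist z0 z = 0 \<Longrightarrow> P z = p z"
proof -
  obtain m where "p \<in> polys_upto m"
    using real_polynomial_function_in_polys_upto[OF p] by blast
  \<comment> \<open>The degree \<open>m - 2\<close> is relaxed to \<open>m\<close>, so that the
    right-hand side lies in the space on which the map is an endomorphism.\<close>
  then have "heat_op p \<in> polys_upto m"
    using polys_upto_mono[OF _ polys_upto_heat_op, of m m] by simp
  have rp: "real_polynomial_function (\<lambda>z. bowl_dist z0 z * q z)" if "q \<in> polys_upto m" for q
    using polys_upto_polynomial[OF that] by (intro real_polynomial_function_mult) auto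
  have "\<exists>q\<in>polys_upto m. heat_op (\<lambda>z. bowl_dist z0 z * q z) = heat_op p"
  proof (rule fun_space.injective_endomorphism_surj[of "polys_upto m" "monomial ` {w. weight w \<le> m}"
        "\<lambda>q. heat_op (\<lambda>z. bowl_dist z0 z * q z)" "heat_op p"])
    show "heat_op (\<lambda>z. bowl_dist z0 z * v z) \<in> polys_upto m" if "v \<in> polys_upto m" for v
      using polys_upto_heat_op[OF polys_upto_mult[OF polys_upto_bowl_dist that]] by simp
    show "heat_op (\<lambda>z. bowl_dist z0 z * (v + w) z) =
        heat_op (\<lambda>z. bowl_dist z0 z * v z) + heat_op (\<lambda>z. bowl_dist z0 z * w z)"
      if "v \<in> polys_upto m" "w \<in> polys_upto m" for v w
      unfolding plus_fun_apply distrib_left heat_op_add[OF rp[OF that(1)] rp[OF that(2)]]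
      by (rule ext) simp
    show "heat_op (\<lambda>z. bowl_dist z0 z * (r * v z)) = (\<lambda>z. r * heat_op (\<lambda>z. bowl_dist z0 z * v z) z)"
      if "v \<in> polys_upto m" for v r
      using heat_op_cmult[OF rp[OF that], of r] by (simp add: mult.left_commute)
    show "v = 0" if "v \<in> polys_upto m" "heat_op (\<lambda>z. bowl_dist z0 z * v z) = 0" for v
      using heat_op_bowl_dist_mult_eq_0[of v z0] that polys_upto_polynomial[OF that(1)] by (simp add: zero_fun_def)
    show "fun_space.subspace (polys_upto m)" "polys_upto m \<subseteq> fun_space.span (monomial ` {w. weight w \<le> m})"
      by (simp_all add: polys_upto_def fun_space.subspace_span)
    show "finite (monomial ` {w :: 'n option list. weight w \<le> m})"
      by (intro finite_imageI finite_weight_le)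
  qed (fact \<open>heat_op p \<in> polys_upto m\<close>)
  then obtain q where q: "q \<in> polys_upto m" "heat_op (\<lambda>z. bowl_dist z0 z * q z) = heat_op p"
    by blast
  show ?thesis
  proof (rule that[of "\<lambda>z. p z - bowl_dist z0 z * q z"])
    show "real_polynomial_function (\<lambda>z. p z - bowl_dist z0 z * q z)"
      by (intro real_polynomial_function_diff p rp q)
    show "heat_op (\<lambda>z. p z - bowl_dist z0 z * q z) = (\<lambda>_. 0)"
      using q heat_op_diff[OF p rp[OF q(1)]] by simp
  qed simp
qed

section \<open>Limits of caloric polynomials\<close>

text \<open>Formulated so as to be stable under differentiation. The regions stay away from the
  paraboloid only, not from the lid \<open>t = T\<close>, because the gradient bound degenerates
  only where \<open>d\<close> is small.\<close>

definition locally_convergent_caloric ::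
    "(real^'n::finite) \<times> real \<Rightarrow> real \<Rightarrow> (nat \<Rightarrow> (real^'n) \<times> real \<Rightarrow> real) \<Rightarrow> bool" where
  "locally_convergent_caloric z0 T F \<longleftrightarrow>
     (\<forall>n. real_polynomial_function (F n) \<and> heat_op (F n) = (\<lambda>_. 0)) \<and>
     (\<forall>\<delta>>0. uniformly_convergent_on {z. \<delta> \<le> bowl_dist z0 z \<and> snd z < T} F)"

text \<open>Raising the bottom by \<open>\<delta>\<close> turns the region
  \<open>\<delta> \<le> d\<close> into a full closed paraboloid, to which the gradient bound
  applies.\<close>

lemma bowl_dist_shift: "bowl_dist (fst z0, snd z0 + \<delta>) z = bowl_dist z0 z - \<delta>"
  by (simp add: bowl_dist_def)

lemma uniformly_convergent_on_sum':
  fixes f :: "'i \<Rightarrow> nat \<Rightarrow> 'a \<Rightarrow> real"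
  assumes "finite I" "\<And>i. i \<in> I \<Longrightarrow> uniformly_convergent_on X (f i)"
  shows "uniformly_convergent_on X (\<lambda>n z. \<Sum>i\<in>I. f i n z)"
  using assms
proof (induction I rule: finite_induct)
  case empty
  then show ?case by (auto simp: uniformly_convergent_on_def intro: uniform_limit_const)
next
  case (insert i I)
  then obtain k l where "uniform_limit X (f i) k sequentially"
      "uniform_limit X (\<lambda>n z. \<Sum>i\<in>I. f i n z) l sequentially"
    unfolding uniformly_convergent_on_def by blast
  from uniform_limit_add[OF this] insert show ?case
    unfolding uniformly_convergent_on_def by auto
qed

text \<open>The gradient bound is applied to \<open>F m - F n\<close> on the paraboloid raised by
  \<open>\<delta> / 2\<close>; where \<open>d \<ge> \<delta>\<close>, the distance to the raised one
  is still at least \<open>\<delta> / 2\<close>.\<close>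

lemma locally_convergent_caloric_space_deriv:
  assumes F: "locally_convergent_caloric z0 T F"
  shows "locally_convergent_caloric z0 T (\<lambda>n. partial_deriv (axis j 1, 0) (F n))"
  unfolding locally_convergent_caloric_def
proof (intro conjI allI impI)
  let ?D = "partial_deriv (axis j 1, 0)"
  have Fn: "real_polynomial_function (F n)" "heat_op (F n) = (\<lambda>_. 0)" for n
    using F by (auto simp: locally_convergent_caloric_def)
  show "real_polynomial_function (?D (F n))" "heat_op (?D (F n)) = (\<lambda>_. 0)" for n
    using Fn by (auto simp: heat_op_partial_deriv partial_deriv_const)
  fix \<delta> :: real assume d: "\<delta> > 0"
  define z1 where "z1 = (fst z0, snd z0 + \<delta> / 2)"
  obtain C where C: "C \<ge> 0"
    "\<And>P M j z. real_polynomial_function P \<Longrightarrow> heat_op P = (\<lambda>_. 0) \<Longrightarrow>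
       (\<And>y. 0 \<le> bowl_dist z1 y \<Longrightarrow> snd y < T \<Longrightarrow> \<bar>P y\<bar> \<le> M) \<Longrightarrow>
       0 \<le> bowl_dist z1 z \<Longrightarrow> snd z < T \<Longrightarrow>
       bowl_dist z1 z * \<bar>partial_deriv (axis j 1, 0) P z\<bar> \<le> C * M"
    using caloric_polynomial_gradient_bound[of z1 T] by blast
  have Cauchy: "uniformly_Cauchy_on {z. \<delta> / 2 \<le> bowl_dist z0 z \<and> snd z < T} F"
    using F half_gt_zero[OF d]
    unfolding locally_convergent_caloric_def uniformly_convergent_eq_Cauchy by blast
  show "uniformly_convergent_on {z. \<delta> \<le> bowl_dist z0 z \<and> snd z < T} (\<lambda>n. ?D (F n))"
    unfolding uniformly_convergent_eq_Cauchy
  proof (rule uniformly_Cauchy_onI)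
    fix e :: real assume e: "e > 0"
    \<comment> \<open>Chosen so that \<open>C * e' < e * (\<delta> / 2)\<close>; the
      \<open>C + 1\<close> covers \<open>C = 0\<close>.\<close>
    define e' where "e' = e * \<delta> / (2 * (C + 1))"
    have e': "e' > 0" "C * e' < e * (\<delta> / 2)"
      using e d C(1) by (auto simp: e'_def field_simps)
    obtain N where N: "\<And>z m n. \<delta> / 2 \<le> bowl_dist z0 z \<Longrightarrow> snd z < T \<Longrightarrow> m \<ge> N \<Longrightarrow> n \<ge> N \<Longrightarrow>
        dist (F m z) (F n z) < e'"
      using Cauchy e'(1) unfolding uniformly_Cauchy_on_def by blast
    show "\<exists>M. \<forall>z\<in>{z. \<delta> \<le> bowl_dist z0 z \<and> snd z < T}. \<forall>m\<ge>M. \<forall>n\<ge>M. dist (?D (F m) z) (?D (F n) z) < e"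
    proof (intro exI[of _ N] ballI allI impI)
      fix z m n assume z: "z \<in> {z. \<delta> \<le> bowl_dist z0 z \<and> snd z < T}" and mn: "m \<ge> N" "n \<ge> N"
      let ?P = "\<lambda>z. F m z - F n z"
      have "bowl_dist z1 z * \<bar>?D ?P z\<bar> \<le> C * e'"
      proof (rule C(2))
        show "real_polynomial_function ?P" "heat_op ?P = (\<lambda>_. 0)"
          using Fn by (auto simp: heat_op_diff intro: real_polynomial_function_diff)
        show "\<bar>F m y - F n y\<bar> \<le> e'" if "0 \<le> bowl_dist z1 y" "snd y < T" for y
          using N[of y m n] that mn by (simp add: z1_def bowl_dist_shift dist_real_def)
      qed (use z d in \<open>auto simp: z1_def bowl_dist_shift\<close>)
      moreover have "\<delta> / 2 * \<bar>?D ?P z\<bar> \<le> bowl_dist z1 z * \<bar>?D ?P z\<bar>"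
        using z by (intro mult_right_mono) (auto simp: z1_def bowl_dist_shift)
      ultimately have "\<bar>?D ?P z\<bar> * (\<delta> / 2) < e * (\<delta> / 2)"
        using e'(2) by (simp add: mult.commute)
      then have "\<bar>?D ?P z\<bar> < e" using d by simp
      then show "dist (?D (F m) z) (?D (F n) z) < e"
        using Fn by (simp add: partial_deriv_diff dist_real_def)
    qed
  qed
qed

text \<open>For caloric functions the time derivative is the Laplacian, so two space derivatives
  suffice.\<close>

lemma locally_convergent_caloric_time_deriv:
  assumes F: "locally_convergent_caloric z0 T F"
  shows "locally_convergent_caloric z0 T (\<lambda>n. partial_deriv (0, 1) (F n))"
  unfolding locally_convergent_caloric_def
proof (intro conjI allI impI)
  have Fn: "real_polynomial_function (F n)" "heat_op (F n) = (\<lambda>_. 0)" for n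
    using F by (auto simp: locally_convergent_caloric_def)
  show "real_polynomial_function (partial_deriv (0, 1) (F n))"
    "heat_op (partial_deriv (0, 1) (F n)) = (\<lambda>_. 0)" for n
    using Fn by (auto simp: heat_op_partial_deriv partial_deriv_const)
  have eq: "partial_deriv (0, 1) (F n) =
      (\<lambda>z. \<Sum>j\<in>UNIV. partial_deriv (axis j 1, 0) (partial_deriv (axis j 1, 0) (F n)) z)" for n
    using Fn(2)[of n] by (simp add: heat_op_eq fun_eq_iff)
  fix \<delta> :: real assume d: "\<delta> > 0"
  have "locally_convergent_caloric z0 T
      (\<lambda>n. partial_deriv (axis j 1, 0) (partial_deriv (axis j 1, 0) (F n)))" for j
    by (intro locally_convergent_caloric_space_deriv F)
  then show "uniformly_convergent_on {z. \<delta> \<le> bowl_dist z0 z \<and> snd z < T} (\<lambda>n. partial_deriv (0, 1) (F n))"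
    unfolding eq using d
    by (intro uniformly_convergent_on_sum') (auto simp: locally_convergent_caloric_def)
qed

lemma Basis_space_time:
  "b \<in> (Basis :: ((real^'n::finite) \<times> real) set) \<longleftrightarrow> (\<exists>j. b = (axis j 1, 0)) \<or> b = (0, 1)"
  by (auto simp: Basis_prod_def Basis_vec_def)

lemma locally_convergent_caloric_deriv:
  assumes "locally_convergent_caloric z0 T F" "b \<in> Basis"
  shows "locally_convergent_caloric z0 T (\<lambda>n. partial_deriv b (F n))"
  using assms locally_convergent_caloric_space_deriv locally_convergent_caloric_time_deriv
  unfolding Basis_space_time by blast

lemma locally_convergent_caloric_uniform_limit:
  assumes "locally_convergent_caloric z0 T F" "\<delta> > 0"
    and "\<forall>z. 0 < bowl_dist z0 z \<longrightarrow> snd z < T \<longrightarrow> (\<lambda>n. F n z) \<longlonglongrightarrow> u z"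
  shows "uniform_limit {z. \<delta> \<le> bowl_dist z0 z \<and> snd z < T} F u sequentially"
proof -
  have "uniform_limit {z. \<delta> \<le> bowl_dist z0 z \<and> snd z < T} F (\<lambda>z. lim (\<lambda>n. F n z)) sequentially"
    using assms by (simp add: locally_convergent_caloric_def uniformly_convergent_uniform_limit_iff)
  moreover have "lim (\<lambda>n. F n z) = u z" if "\<delta> \<le> bowl_dist z0 z" "snd z < T" for z
    using assms(2) that by (intro limI assms(3)[rule_format]) auto
  ultimately show ?thesis
    by (subst (asm) uniform_limit_cong'[of _ F F _ u]) auto
qed

lemma locally_convergent_caloric_pointwise:
  assumes "locally_convergent_caloric z0 T F" "0 < bowl_dist z0 z" "snd z < T"
  shows "(\<lambda>n. F n z) \<longlonglongrightarrow> lim (\<lambda>n. F n z)"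
proof -
  have "uniform_limit {y. bowl_dist z0 z \<le> bowl_dist z0 y \<and> snd y < T} F (\<lambda>z. lim (\<lambda>n. F n z)) sequentially"
    using assms by (simp add: locally_convergent_caloric_def uniformly_convergent_uniform_limit_iff)
  then show ?thesis by (rule tendsto_uniform_limitI) (use assms in auto)
qed

lemma locally_convergent_caloric_continuous:
  assumes F: "locally_convergent_caloric z0 T F"
    and u: "\<forall>z. 0 < bowl_dist z0 z \<longrightarrow> snd z < T \<longrightarrow> (\<lambda>n. F n z) \<longlonglongrightarrow> u z"
  shows "continuous_on {z. 0 < bowl_dist z0 z \<and> snd z < T} u"
proof (intro continuous_at_imp_continuous_on ballI)
  fix z assume z: "z \<in> {z. 0 < bowl_dist z0 z \<and> snd z < T}"
  \<comment> \<open>Half the distance keeps a neighbourhood of \<open>z\<close> inside a region of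
    uniform convergence.\<close>
  define \<delta> where "\<delta> = bowl_dist z0 z / 2"
  have d: "0 < \<delta>" "\<delta> < bowl_dist z0 z" using z by (auto simp: \<delta>_def)
  have "continuous_on {z. \<delta> \<le> bowl_dist z0 z \<and> snd z < T} u"
  proof (rule uniform_limit_theorem[OF _ locally_convergent_caloric_uniform_limit[OF F d(1) u]])
    show "\<forall>\<^sub>F n in sequentially. continuous_on {z. \<delta> \<le> bowl_dist z0 z \<and> snd z < T} (F n)"
      using F by (simp add: locally_convergent_caloric_def continuous_on_polymonial_function
          real_polynomial_function_eq)
  qed auto
  then have "continuous_on {z. \<delta> < bowl_dist z0 z \<and> snd z < T} u"
    by (rule continuous_on_subset) auto
  moreover have "open {z. \<delta> < bowl_dist z0 z \<and> snd z < T}"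
    by (intro open_Collect_conj open_Collect_less continuous_intros)
  moreover have "z \<in> {z. \<delta> < bowl_dist z0 z \<and> snd z < T}" using z d by simp
  ultimately show "isCont u z" using continuous_on_eq_continuous_at by blast
qed

text \<open>Termwise differentiation on a segment through \<open>z\<close> in direction
  \<open>b\<close>: the differentiated sequence is again of the same kind, so it converges uniformly
  near \<open>z\<close>.\<close>

lemma locally_convergent_caloric_has_deriv:
  assumes F: "locally_convergent_caloric z0 T F"
    and u: "\<forall>z. 0 < bowl_dist z0 z \<longrightarrow> snd z < T \<longrightarrow> (\<lambda>n. F n z) \<longlonglongrightarrow> u z"
    and b: "b \<in> Basis" and z: "0 < bowl_dist z0 z" "snd z < T"
  shows "((\<lambda>h. u (z + h *\<^sub>R b)) has_field_derivative lim (\<lambda>n. partial_deriv b (F n) z)) (at 0)"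
proof -
  define v where "v = (\<lambda>z. lim (\<lambda>n. partial_deriv b (F n) z))"
  define \<delta> where "\<delta> = bowl_dist z0 z / 2"
  have d: "0 < \<delta>" "\<delta> < bowl_dist z0 z" using z by (auto simp: \<delta>_def)
  let ?U = "{z. \<delta> < bowl_dist z0 z \<and> snd z < T}"
  have "open ?U"
    by (intro open_Collect_conj open_Collect_less continuous_intros)
  moreover have "isCont (\<lambda>h. z + h *\<^sub>R b) 0" by (intro continuous_intros)
  ultimately have "\<forall>\<^sub>F h in at 0. z + h *\<^sub>R b \<in> ?U"
    using z d by (intro topological_tendstoD[of "\<lambda>h. z + h *\<^sub>R b" "z + 0 *\<^sub>R b"]) (auto simp: isCont_def)
  then obtain e where e: "e > 0" "\<And>h. h \<noteq> 0 \<Longrightarrow> \<bar>h\<bar> < e \<Longrightarrow> z + h *\<^sub>R b \<in> ?U"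
    unfolding eventually_at by (auto simp: dist_real_def)
  have eU: "z + h *\<^sub>R b \<in> ?U" if "h \<in> ball 0 e" for h
    using that e(2)[of h] z d by (cases "h = 0") auto
  have F': "locally_convergent_caloric z0 T (\<lambda>n. partial_deriv b (F n))"
    by (rule locally_convergent_caloric_deriv[OF F b])
  have unif: "uniform_limit {z. \<delta> \<le> bowl_dist z0 z \<and> snd z < T} (\<lambda>n. partial_deriv b (F n)) v sequentially"
    using locally_convergent_caloric_pointwise[OF F']
    by (intro locally_convergent_caloric_uniform_limit[OF F' d(1)]) (simp add: v_def)
  have "\<exists>g. \<forall>h\<in>ball 0 e. (\<lambda>n. F n (z + h *\<^sub>R b)) \<longlonglongrightarrow> g h \<and>
      (g has_derivative (\<lambda>k. v (z + h *\<^sub>R b) * k)) (at h within ball 0 e)"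
  proof (rule has_derivative_sequence[where f' = "\<lambda>n h k. partial_deriv b (F n) (z + h *\<^sub>R b) * k"])
    show "((\<lambda>h. F n (z + h *\<^sub>R b)) has_derivative (\<lambda>k. partial_deriv b (F n) (z + h *\<^sub>R b) * k))
        (at h within ball 0 e)" for n h
      using polynomial_has_partial_deriv_at[of "F n" z b h] F
      by (auto simp: locally_convergent_caloric_def has_field_derivative_def
          intro: has_derivative_at_withinI)
    show "\<forall>\<^sub>F n in sequentially. \<forall>h\<in>ball 0 e. \<forall>k.
        norm (partial_deriv b (F n) (z + h *\<^sub>R b) * k - v (z + h *\<^sub>R b) * k) \<le> \<epsilon> * norm k"
      if "\<epsilon> > 0" for \<epsilon>
      using uniform_limitD[OF unif that]
    proof eventually_elim
      case (elim n)
      show ?case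
      proof (intro ballI allI)
        fix h k :: real assume "h \<in> ball 0 e"
        then have "\<bar>partial_deriv b (F n) (z + h *\<^sub>R b) - v (z + h *\<^sub>R b)\<bar> \<le> \<epsilon>"
          using bspec[OF elim, of "z + h *\<^sub>R b"] eU[of h] by (simp add: dist_real_def)
        then show "norm (partial_deriv b (F n) (z + h *\<^sub>R b) * k - v (z + h *\<^sub>R b) * k) \<le> \<epsilon> * norm k"
          by (simp add: left_diff_distrib[symmetric] abs_mult mult_right_mono)
      qed
    qed
    show "(\<lambda>n. F n (z + 0 *\<^sub>R b)) \<longlonglongrightarrow> u z" using u[rule_format, OF z] by simp
  qed (use e in auto)
  then obtain g where g: "\<And>h. h \<in> ball 0 e \<Longrightarrow> (\<lambda>n. F n (z + h *\<^sub>R b)) \<longlonglongrightarrow> g h"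
      "\<And>h. h \<in> ball 0 e \<Longrightarrow> (g has_derivative (\<lambda>k. v (z + h *\<^sub>R b) * k)) (at h within ball 0 e)"
    by blast
  \<comment> \<open>The sequence theorem yields some limit function \<open>g\<close>; uniqueness of
    limits identifies it with \<open>u\<close> along the segment.\<close>
  have "g h = u (z + h *\<^sub>R b)" if "h \<in> ball 0 e" for h
    using g(1)[OF that] u[rule_format, of "z + h *\<^sub>R b"] eU[OF that] d by (intro LIMSEQ_unique) auto
  moreover have "(g has_field_derivative v z) (at 0)"
    using g(2)[of 0] e(1) by (simp add: has_field_derivative_def at_within_open[of 0 "ball 0 e"])
  ultimately show ?thesis
    unfolding v_def has_field_derivative_def
    by (rule has_derivative_transform_within_open[of _ _ 0 UNIV "ball 0 e", rotated 3]) (use e in auto)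
qed

lemma locally_convergent_caloric_partial_deriv:
  assumes F: "locally_convergent_caloric z0 T F"
    and u: "\<forall>z. 0 < bowl_dist z0 z \<longrightarrow> snd z < T \<longrightarrow> (\<lambda>n. F n z) \<longlonglongrightarrow> u z"
    and b: "b \<in> Basis" and z: "0 < bowl_dist z0 z" "snd z < T"
  shows "(\<lambda>n. partial_deriv b (F n) z) \<longlonglongrightarrow> partial_deriv b u z"
proof -
  have "partial_deriv b u z = lim (\<lambda>n. partial_deriv b (F n) z)"
    using locally_convergent_caloric_has_deriv[OF assms] by (simp add: partial_deriv_def DERIV_imp_deriv)
  then show ?thesis
    using locally_convergent_caloric_pointwise[OF locally_convergent_caloric_deriv[OF F b] z] by simp
qed

text \<open>Induction on \<open>k\<close> for all \<open>F\<close> and \<open>u\<close> at once: a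
  partial derivative of \<open>u\<close> is the limit of the differentiated sequence, which
  satisfies the same hypotheses.\<close>

lemma locally_convergent_caloric_Ck:
  assumes F: "locally_convergent_caloric z0 T F"
    and u: "\<forall>z. 0 < bowl_dist z0 z \<longrightarrow> snd z < T \<longrightarrow> (\<lambda>n. F n z) \<longlonglongrightarrow> u z"
  shows "Ck_on k u {z. 0 < bowl_dist z0 z \<and> snd z < T}"
  using assms
proof (induction k arbitrary: F u)
  case 0
  then show ?case by (auto intro: locally_convergent_caloric_continuous)
next
  case (Suc k)
  have "continuous_on {z. 0 < bowl_dist z0 z \<and> snd z < T} u"
    by (rule locally_convergent_caloric_continuous[OF Suc.prems])
  moreover have "Ck_on k (partial_deriv b u) {z. 0 < bowl_dist z0 z \<and> snd z < T}" if "b \<in> Basis" for b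
    by (intro Suc.IH[OF locally_convergent_caloric_deriv[OF Suc.prems(1) that]] allI impI
          locally_convergent_caloric_partial_deriv[OF Suc.prems that])
  moreover have "(\<lambda>h. u (z + h *\<^sub>R b)) field_differentiable (at 0)"
    if "b \<in> Basis" "0 < bowl_dist z0 z" "snd z < T" for b z
    using locally_convergent_caloric_has_deriv[OF Suc.prems that]
    by (auto simp: field_differentiable_def)
  ultimately show ?case by auto
qed

lemma locally_convergent_caloric_limit:
  assumes F: "locally_convergent_caloric z0 T F"
    and u: "\<forall>z. 0 < bowl_dist z0 z \<longrightarrow> snd z < T \<longrightarrow> (\<lambda>n. F n z) \<longlonglongrightarrow> u z"
  shows "caloric_on u {z. 0 < bowl_dist z0 z \<and> snd z < T}"
  unfolding caloric_on_def Cinf_on_def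
proof (intro conjI allI ballI)
  show "Ck_on k u {z. 0 < bowl_dist z0 z \<and> snd z < T}" for k
    by (rule locally_convergent_caloric_Ck[OF assms])
  fix z assume "z \<in> {z. 0 < bowl_dist z0 z \<and> snd z < T}"
  then have z: "0 < bowl_dist z0 z" "snd z < T" by auto
  note lim = locally_convergent_caloric_partial_deriv[OF assms]
  have B: "(axis j 1, 0) \<in> (Basis :: ((real^'a) \<times> real) set)" "(0, 1) \<in> (Basis :: ((real^'a) \<times> real) set)" for j :: 'a
    by (auto simp: Basis_space_time)
  have lim2: "(\<lambda>n. partial_deriv (axis j 1, 0) (partial_deriv (axis j 1, 0) (F n)) z)
      \<longlonglongrightarrow> partial_deriv (axis j 1, 0) (partial_deriv (axis j 1, 0) u) z" for j
    using lim[OF B(1)]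
    by (intro locally_convergent_caloric_partial_deriv[OF locally_convergent_caloric_deriv[OF F B(1)] _ B(1) z])
      blast
  have "(\<lambda>n. heat_op (F n) z) \<longlonglongrightarrow> heat_op u z"
    unfolding heat_op_eq
    by (intro tendsto_diff tendsto_sum lim lim2 B z)
  moreover have "heat_op (F n) z = 0" for n
    using F by (simp add: locally_convergent_caloric_def)
  ultimately show "heat_op u z = 0" by (simp add: LIMSEQ_const_iff)
qed

section \<open>The Dirichlet problem in the bowl\<close>

text \<open>\<open>Ck_on\<close> gives derivatives at parameter 0 from each base point, the jet
  wants them at all small parameters; openness of \<open>S\<close> allows moving the base point
  along the axis.\<close>

lemma heat_jet_of_C2:
  fixes u :: "(real^'n::finite) \<times> real \<Rightarrow> real"
  assumes "open S" and C2: "Ck_on (Suc (Suc 0)) u S" and z: "z \<in> S"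
  shows "heat_jet u z (heat_op u z)"
proof -
  have d1: "((\<lambda>h. u (y + h *\<^sub>R b)) has_field_derivative partial_deriv b u y) (at 0)"
    and d2: "((\<lambda>h. partial_deriv b u (y + h *\<^sub>R b))
        has_field_derivative partial_deriv b (partial_deriv b u) y) (at 0)"
    if "b \<in> Basis" "y \<in> S" for b y
  proof -
    have "(\<lambda>h. u (y + h *\<^sub>R b)) field_differentiable (at 0)"
      "(\<lambda>h. partial_deriv b u (y + h *\<^sub>R b)) field_differentiable (at 0)"
      using C2 that unfolding Ck_on.simps by blast+
    then show "((\<lambda>h. u (y + h *\<^sub>R b)) has_field_derivative partial_deriv b u y) (at 0)"
      "((\<lambda>h. partial_deriv b u (y + h *\<^sub>R b))
        has_field_derivative partial_deriv b (partial_deriv b u) y) (at 0)"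
      unfolding partial_deriv_def[of b u y] partial_deriv_def[of b "partial_deriv b u" y]
      by (simp_all only: DERIV_deriv_iff_field_differentiable)
  qed
  have B: "(axis j 1, 0) \<in> (Basis :: ((real^'n) \<times> real) set)" "(0, 1) \<in> (Basis :: ((real^'n) \<times> real) set)" for j :: 'n
    by (auto simp: Basis_space_time)
  show ?thesis
    unfolding heat_jet_def
  proof (intro exI conjI allI)
    fix j
    let ?e = "(axis j 1, 0) :: (real^'n) \<times> real"
    have shift: "z + h *\<^sub>R e + k *\<^sub>R e = z + (k + h) *\<^sub>R e" for h k and e :: "(real^'n) \<times> real"
      by (simp add: algebra_simps)
    have "isCont (\<lambda>h. z + h *\<^sub>R ?e) 0" by (intro continuous_intros)
    then have "filterlim (\<lambda>h. z + h *\<^sub>R ?e) (nhds z) (nhds 0)"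
      using tendsto_at_iff_tendsto_nhds[of "\<lambda>h. z + h *\<^sub>R ?e" 0]
      by (simp add: isCont_def zero_prod_def[symmetric])
    then have "\<forall>\<^sub>F h in nhds 0. z + h *\<^sub>R ?e \<in> S"
      using \<open>open S\<close> z by (rule topological_tendstoD)
    then show "\<forall>\<^sub>F h in nhds 0. ((\<lambda>h. u (z + h *\<^sub>R (axis j 1, 0)))
        has_field_derivative partial_deriv (axis j 1, 0) u (z + h *\<^sub>R (axis j 1, 0))) (at h)"
    proof eventually_elim
      case (elim h)
      have "((\<lambda>k. u (z + h *\<^sub>R ?e + k *\<^sub>R ?e)) has_field_derivative partial_deriv ?e u (z + h *\<^sub>R ?e)) (at 0)"
        by (rule d1[OF B(1) elim])
      then have "((\<lambda>k. u (z + (k + h) *\<^sub>R ?e)) has_field_derivative partial_deriv ?e u (z + h *\<^sub>R ?e)) (at 0)"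
        unfolding shift .
      then show ?case
        using DERIV_shift[of "\<lambda>h. u (z + h *\<^sub>R ?e)" _ 0 h] by simp
    qed
    show "((\<lambda>h. partial_deriv (axis j 1, 0) u (z + h *\<^sub>R (axis j 1, 0)))
        has_field_derivative partial_deriv (axis j 1, 0) (partial_deriv (axis j 1, 0) u) z) (at 0)"
      by (rule d2[OF B(1) z])
  next
    show "((\<lambda>h. u (z + h *\<^sub>R (0, 1))) has_field_derivative partial_deriv (0, 1) u z) (at 0)"
      by (rule d1[OF B(2) z])
  qed (simp add: heat_op_eq)
qed

text \<open>The maximum principle reaches times below \<open>t0 + r^2\<close> only. The rim at the
  top belongs to the normal boundary, so boundary points are settled first and every other point
  lies in the bowl.\<close>

lemma bowl_comparison:
  assumes cont: "continuous_on (bowl z0 r \<union> normal_boundary z0 r) u"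
      "continuous_on (bowl z0 r \<union> normal_boundary z0 r) v"
    and jet: "\<And>z. z \<in> bowl z0 r \<Longrightarrow> heat_jet u z 0 \<and> heat_jet v z 0"
    and le: "\<And>z. z \<in> normal_boundary z0 r \<Longrightarrow> u z \<le> v z"
    and z: "z \<in> bowl z0 r \<union> normal_boundary z0 r"
  shows "u z \<le> v z"
proof (cases "z \<in> normal_boundary z0 r")
  case True
  then show ?thesis by (rule le)
next
  case False
  have "u z - v z \<le> 0"
  proof (rule weak_max_principle[of z0 "snd z0 + r\<^sup>2" "\<lambda>z. u z - v z"])
    have "{z. 0 \<le> bowl_dist z0 z \<and> snd z < snd z0 + r\<^sup>2} \<subseteq> bowl z0 r \<union> normal_boundary z0 r"
      by (auto simp: bowl_eq normal_boundary_eq)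
    then show "continuous_on {z. 0 \<le> bowl_dist z0 z \<and> snd z < snd z0 + r\<^sup>2} (\<lambda>z. u z - v z)"
      by (intro continuous_on_diff continuous_on_subset[OF cont(1)] continuous_on_subset[OF cont(2)])
    show "\<exists>L\<ge>0. heat_jet (\<lambda>z. u z - v z) z L" if "0 < bowl_dist z0 z" "snd z < snd z0 + r\<^sup>2" for z
    proof -
      have "z \<in> bowl z0 r" using that by (simp add: bowl_eq)
      then have "heat_jet (\<lambda>z. u z - v z) z (0 - 0)"
        using jet by (intro heat_jet_diff) blast+
      then show ?thesis by (intro exI[of _ "0 - 0"]) simp
    qed
    show "u y - v y \<le> 0" if "bowl_dist z0 y = 0" "snd y < snd z0 + r\<^sup>2" for y
    proof -
      have "y \<in> normal_boundary z0 r" using that by (simp add: normal_boundary_eq)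
      then show ?thesis using le[of y] by simp
    qed
    show "0 \<le> bowl_dist z0 z" "snd z < snd z0 + r\<^sup>2"
      using z False by (simp_all add: bowl_eq)
  qed
  then show ?thesis by simp
qed

section \<open>Existence of the solution, then the theorem\<close>

lemma open_bowl: "open (bowl z0 r)"
  unfolding bowl_eq by (intro open_Collect_conj open_Collect_less continuous_intros)

lemma compact_normal_boundary: "compact (normal_boundary z0 r)"
proof -
  have "normal_boundary z0 r = {z. 0 \<le> bowl_dist z0 z \<and> snd z \<le> snd z0 + r\<^sup>2} \<inter> {z. bowl_dist z0 z = 0}"
    by (auto simp: normal_boundary_eq)
  moreover have "closed {z. bowl_dist z0 z = 0}"
    by (intro closed_Collect_eq continuous_intros)
  ultimately show ?thesis by (simp only: compact_Int_closed[OF compact_bowl_dist])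
qed

lemma bowl_solution_heat_jet:
  assumes "bowl_solution z0 r \<phi> u" "z \<in> bowl z0 r"
  shows "heat_jet u z 0"
proof -
  have C2: "Ck_on (Suc (Suc 0)) u (bowl z0 r)" and 0: "heat_op u z = 0"
    using assms by (simp_all only: bowl_solution_def caloric_on_def Cinf_on_def)
  show ?thesis
    using heat_jet_of_C2[OF open_bowl C2 assms(2)] by (simp only: 0)
qed

lemma bowl_solution_exists:
  fixes z0 :: "(real^'n::finite) \<times> real"
  assumes \<phi>: "continuous_on (normal_boundary z0 r) \<phi>"
  shows "\<exists>u. bowl_solution z0 r \<phi> u"
proof -
  let ?X = "bowl z0 r \<union> normal_boundary z0 r" and ?T = "snd z0 + r\<^sup>2"
  have "\<exists>P. real_polynomial_function P \<and> heat_op P = (\<lambda>_. 0) \<and>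
      (\<forall>z\<in>normal_boundary z0 r. \<bar>\<phi> z - P z\<bar> < 1 / Suc n)" for n
  proof -
    obtain p where p: "real_polynomial_function p" "\<And>z. z \<in> normal_boundary z0 r \<Longrightarrow> \<bar>\<phi> z - p z\<bar> < 1 / Suc n"
      using Stone_Weierstrass_real_polynomial_function[OF compact_normal_boundary \<phi>, of "1 / Suc n"] by auto
    obtain P where "real_polynomial_function P" "heat_op P = (\<lambda>_. 0)" "\<And>z. bowl_dist z0 z = 0 \<Longrightarrow> P z = p z"
      using caloric_polynomial_extension[OF p(1), of z0] by blast
    then show ?thesis using p(2) by (auto simp: normal_boundary_eq)
  qed
  then have "\<exists>P. \<forall>n. real_polynomial_function (P n) \<and> heat_op (P n) = (\<lambda>_. 0) \<and>
      (\<forall>z\<in>normal_boundary z0 r. \<bar>\<phi> z - P n z\<bar> < 1 / Suc n)"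
    by (intro choice allI)
  then obtain P where P: "\<And>n. real_polynomial_function (P n)" "\<And>n. heat_op (P n) = (\<lambda>_. 0)"
    and P\<phi>: "\<And>n z. z \<in> normal_boundary z0 r \<Longrightarrow> \<bar>\<phi> z - P n z\<bar> < 1 / Suc n"
    by blast
  have bd: "\<bar>P m z - P n z\<bar> \<le> 1 / Suc m + 1 / Suc n" if "z \<in> normal_boundary z0 r" for m n z
    using P\<phi>[OF that, of m] P\<phi>[OF that, of n] by linarith
  \<comment> \<open>As before, boundary points including the rim are treated directly and the bowl
    by the maximum principle.\<close>
  have est: "\<bar>P m z - P n z\<bar> \<le> 1 / Suc m + 1 / Suc n" if "z \<in> ?X" for m n z
  proof (cases "z \<in> normal_boundary z0 r")
    case True
    then show ?thesis by (rule bd)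
  next
    case False
    show ?thesis
    proof (rule caloric_polynomial_abs_max[of "\<lambda>z. P m z - P n z" z0 ?T])
      show "real_polynomial_function (\<lambda>z. P m z - P n z)" "heat_op (\<lambda>z. P m z - P n z) = (\<lambda>_. 0)"
        using P by (auto simp: heat_op_diff intro: real_polynomial_function_diff)
    qed (use bd False that in \<open>auto simp: bowl_eq normal_boundary_eq\<close>)
  qed
  have "uniformly_Cauchy_on ?X P"
  proof (rule uniformly_Cauchy_onI)
    fix e :: real assume "e > 0"
    then obtain N where N: "1 / Suc N < e / 2"
      using nat_approx_posE[of "e / 2"] by auto
    have "dist (P m z) (P n z) < e" if "z \<in> ?X" "m \<ge> N" "n \<ge> N" for z m n
    proof -
      have "1 / Suc m \<le> 1 / Suc N" "1 / Suc n \<le> 1 / Suc N"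
        using that by (auto simp: frac_le)
      then show ?thesis using est[OF that(1), of m n] N by (simp add: dist_real_def)
    qed
    then show "\<exists>M. \<forall>z\<in>?X. \<forall>m\<ge>M. \<forall>n\<ge>M. dist (P m z) (P n z) < e" by blast
  qed
  then have conv: "uniformly_convergent_on ?X P"
    by (rule Cauchy_uniformly_convergent)
  then obtain l where l: "uniform_limit ?X P l sequentially"
    unfolding uniformly_convergent_on_def by blast
  \<comment> \<open>Restriction gives the membership in \<open>extensional\<close>; the limit is
    unchanged on the domain.\<close>
  define u where "u = restrict l ?X"
  have u: "uniform_limit ?X P u sequentially"
    using l by (subst (asm) uniform_limit_cong'[of _ P P _ u]) (auto simp: u_def)
  have lim: "(\<lambda>n. P n z) \<longlonglongrightarrow> u z" if "z \<in> ?X" for z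
    by (rule tendsto_uniform_limitI[OF u that])
  \<comment> \<open>For \<open>\<delta> > 0\<close> the region \<open>\<delta> \<le> d\<close>,
    \<open>t < t0 + r^2\<close> lies in the bowl, where convergence is uniform.\<close>
  have "locally_convergent_caloric z0 ?T P"
    unfolding locally_convergent_caloric_def
    using P by (auto intro!: uniformly_convergent_on_subset[OF conv] simp: bowl_eq)
  then have "caloric_on u (bowl z0 r)"
    unfolding bowl_eq by (rule locally_convergent_caloric_limit) (auto intro: lim simp: bowl_eq)
  moreover have "continuous_on ?X u"
    by (rule uniform_limit_theorem[OF _ u])
      (use P in \<open>auto simp: continuous_on_polymonial_function real_polynomial_function_eq\<close>)
  moreover have "u z = \<phi> z" if z: "z \<in> normal_boundary z0 r" for z
  proof (rule LIMSEQ_unique[of "\<lambda>n. P n z"])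
    show "(\<lambda>n. P n z) \<longlonglongrightarrow> u z" using z by (intro lim) auto
    show "(\<lambda>n. P n z) \<longlonglongrightarrow> \<phi> z"
    proof (rule LIM_zero_cancel, rule Lim_null_comparison)
      show "\<forall>\<^sub>F n in sequentially. norm (P n z - \<phi> z) \<le> 1 / Suc n"
        using P\<phi>[OF z] by (intro always_eventually allI) (simp add: abs_minus_commute less_imp_le)
      show "(\<lambda>n. 1 / Suc n) \<longlonglongrightarrow> 0" by (rule LIMSEQ_Suc[OF lim_1_over_n])
    qed
  qed
  ultimately have "bowl_solution z0 r \<phi> u"
    by (auto simp: bowl_solution_def u_def)
  then show ?thesis by (rule exI[of _ u])
qed

theorem theorem2p1:
  fixes z0 :: "(real^'n::finite) \<times> real" and r :: real
    and \<phi> :: "(real^'n) \<times> real \<Rightarrow> real"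
  assumes "r > 0"
    and "continuous_on (normal_boundary z0 r) \<phi>"
  shows "(\<exists>!u. bowl_solution z0 r \<phi> u) \<and>
    ((\<forall>z\<in>normal_boundary z0 r. \<phi> z \<ge> 0) \<longrightarrow>
      (\<forall>u. bowl_solution z0 r \<phi> u \<longrightarrow>
        (\<forall>z \<in> bowl z0 r \<union> normal_boundary z0 r. u z \<ge> 0)))"
proof (intro conjI impI allI ballI ex_ex1I)
  show "\<exists>u. bowl_solution z0 r \<phi> u"
    by (rule bowl_solution_exists[OF assms(2)])
next
  fix u v assume uv: "bowl_solution z0 r \<phi> u" "bowl_solution z0 r \<phi> v"
  have le: "a z \<le> b z" if "bowl_solution z0 r \<phi> a" "bowl_solution z0 r \<phi> b"
    "z \<in> bowl z0 r \<union> normal_boundary z0 r" for a b z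
  proof (rule bowl_comparison[OF _ _ _ _ that(3)])
    show "heat_jet a y 0 \<and> heat_jet b y 0" if "y \<in> bowl z0 r" for y
      using bowl_solution_heat_jet \<open>bowl_solution z0 r \<phi> a\<close> \<open>bowl_solution z0 r \<phi> b\<close> that by blast
  qed (use that(1,2) in \<open>simp_all add: bowl_solution_def\<close>)
  show "u = v"
  proof (rule extensionalityI)
    show "u z = v z" if "z \<in> bowl z0 r \<union> normal_boundary z0 r" for z
      using le[OF uv that] le[OF uv(2,1) that] by (rule antisym)
  qed (use uv in \<open>auto simp: bowl_solution_def\<close>)
next
  fix u z
  assume \<phi>: "\<forall>z\<in>normal_boundary z0 r. \<phi> z \<ge> 0" and u: "bowl_solution z0 r \<phi> u"
    and z: "z \<in> bowl z0 r \<union> normal_boundary z0 r"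
  show "0 \<le> u z"
  proof (rule bowl_comparison[of z0 r "\<lambda>_. 0" u, OF _ _ _ _ z])
    show "heat_jet (\<lambda>_. 0) y 0 \<and> heat_jet u y 0" if "y \<in> bowl z0 r" for y
      using bowl_solution_heat_jet[OF u that] heat_jet_time[of 0 y] by simp
  qed (use u \<phi> in \<open>auto simp: bowl_solution_def\<close>)
qed

end
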